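(* Given two VAS $\mathcal V_1,\mathcal V_2$ (of the same dimension), it is undecidable whether $\downarrow_{\le_{\{1\}}}\mathrm{Post}^*(\mathcal V_1)=\downarrow_{\le_{\{1\}}}\mathrm{Post}^*(\mathcal V_2)$.
   Context: A VAS of dimension $d$ is $\mathcal V=\langle A,\delta,\vec x_{in}\rangle$ with $A$ a finite alphabet, $\delta:A\to\mathbb Z^d$, $\vec x_{in}\in\mathbb N^d$; for $\vec x,\vec y\in\mathbb N^d$, $\vec x\xrightarrow{a}\vec y$ iff $\vec y-\vec x=\delta(a)$, extended to words; $\mathrm{Post}^*(\mathcal V)=\{\vec y\in\mathbb N^d\mid\exists u\in A^*,\ \vec x_{in}\xrightarrow{u}\vec y\}$. For $P\subseteq\{1,\dots,d\}$, the order $\le_P$ on $\mathbb N_\omega^d$ ($\mathbb N_\omega=\mathbb N\cup\{\omega\}$, $n\le\omega$) is: $\vec x\le_P\vec y$ iff $\vec x(i)=\vec y(i)$ for $i\in P$ and $\vec x(i)\le\vec y(i)$ for $i\notin P$. For a set $Y$, $\downarrow_{\le_P}Y=\{\vec x\mid\exists\vec y\in Y,\ \vec x\le_P\vec y\}$. *)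

theory Defs
  imports "HOL-Library.Extended_Nat" "HOL-Library.FuncSet" "HOL-Library.Nat_Bijection"
begin

text \<open>A vector of dimension \<open>d\<close> is a list of length \<open>d\<close>; its components are numbered from \<open>1\<close> to \<open>d\<close>.\<close>

definition component :: "'a list \<Rightarrow> nat \<Rightarrow> 'a" where
  "component x i = x ! (i - 1)"

section \<open>Vector addition systems\<close>

record 'a vas =
  alphabet :: "'a set"
  disp :: "'a \<Rightarrow> int list"
  initial :: "nat list"

definition dimension :: "'a vas \<Rightarrow> nat" where
  "dimension V = length (initial V)"

text \<open>The extensional function space makes \<open>disp V\<close> a function on the alphabet only, so that a
  VAS is determined by finitely many data.\<close>

definition is_vas :: "'a vas \<Rightarrow> bool" where
  "is_vas V \<longleftrightarrow> finite (alphabet V) \<and>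
     disp V \<in> alphabet V \<rightarrow>\<^sub>E {v. length v = dimension V}"

definition step :: "'a vas \<Rightarrow> nat list \<Rightarrow> 'a \<Rightarrow> nat list \<Rightarrow> bool" where
  "step V x a y \<longleftrightarrow> a \<in> alphabet V \<and> length x = dimension V \<and> length y = dimension V \<and>
     (\<forall>i\<in>{1..dimension V}. int (component y i) - int (component x i) = component (disp V a) i)"

fun run :: "'a vas \<Rightarrow> nat list \<Rightarrow> 'a list \<Rightarrow> nat list \<Rightarrow> bool" where
  "run V x [] y \<longleftrightarrow> x = y"
| "run V x (a # u) y \<longleftrightarrow> (\<exists>z. step V x a z \<and> run V z u y)"

definition post_star :: "'a vas \<Rightarrow> nat list set" where
  "post_star V = {y. \<exists>u\<in>lists (alphabet V). run V (initial V) u y}"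

section \<open>Downward closures\<close>

definition le_on :: "nat set \<Rightarrow> enat list \<Rightarrow> enat list \<Rightarrow> bool" where
  "le_on P x y \<longleftrightarrow> length x = length y \<and>
     (\<forall>i\<in>{1..length x}. if i \<in> P then component x i = component y i
                       else component x i \<le> component y i)"

definition down_closure :: "nat set \<Rightarrow> enat list set \<Rightarrow> enat list set" where
  "down_closure P Y = {x. \<exists>y\<in>Y. le_on P x y}"

definition embed_omega :: "nat list \<Rightarrow> enat list" where
  "embed_omega x = map enat x"

section \<open>Partial recursive functions\<close>

datatype recf =
    Zero
  | Succ
  | Proj nat
  | Comp recf "recf list"
  | PrimRec recf recf
  | Mu recf

text \<open>\<open>rec_eval f xs y\<close>: the partial function denoted by \<open>f\<close> is defined at the argument tuple
  \<open>xs\<close> and has value \<open>y\<close> there. Recursion and minimisation act on the first argument.\<close>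

inductive rec_eval :: "recf \<Rightarrow> nat list \<Rightarrow> nat \<Rightarrow> bool" where
  Zero: "rec_eval Zero xs 0"
| Succ: "rec_eval Succ [x] (Suc x)"
| Proj: "i < length xs \<Longrightarrow> rec_eval (Proj i) xs (xs ! i)"
| Comp: "list_all2 (\<lambda>g y. rec_eval g xs y) gs ys \<Longrightarrow> rec_eval f ys z \<Longrightarrow>
    rec_eval (Comp f gs) xs z"
| PrimRec_0: "rec_eval f xs y \<Longrightarrow> rec_eval (PrimRec f g) (0 # xs) y"
| PrimRec_Suc: "rec_eval (PrimRec f g) (n # xs) y \<Longrightarrow> rec_eval g (n # y # xs) z \<Longrightarrow>
    rec_eval (PrimRec f g) (Suc n # xs) z"
| Mu: "rec_eval f (n # xs) 0 \<Longrightarrow> (\<And>i. i < n \<Longrightarrow> \<exists>y. rec_eval f (i # xs) (Suc y)) \<Longrightarrow>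
    rec_eval (Mu f) xs n"

inductive_cases rec_eval_ZeroE: "rec_eval Zero xs z"
inductive_cases rec_eval_SuccE: "rec_eval Succ xs z"
inductive_cases rec_eval_ProjE: "rec_eval (Proj i) xs z"
inductive_cases rec_eval_CompE: "rec_eval (Comp f gs) xs z"
inductive_cases rec_eval_PrimRec_0E: "rec_eval (PrimRec f g) (0 # xs) z"
inductive_cases rec_eval_PrimRec_SucE: "rec_eval (PrimRec f g) (Suc n # xs) z"
inductive_cases rec_eval_MuE: "rec_eval (Mu f) xs z"

lemma rec_eval_deterministic: "rec_eval f xs y \<Longrightarrow> rec_eval f xs z \<Longrightarrow> y = z"
proof (induction arbitrary: z rule: rec_eval.induct)
  case (Comp xs gs ys f v)
  from Comp.prems obtain ys' where
    ys': "list_all2 (\<lambda>g y. rec_eval g xs y) gs ys'" "rec_eval f ys' z"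
    by (rule rec_eval_CompE)
  have "ys = ys'"
    using Comp.IH(1) ys'(1) by (auto simp: list_all2_conv_all_nth intro: nth_equalityI)
  with Comp.IH(2) ys'(2) show ?case by simp
next
  case (PrimRec_Suc f g n xs y v)
  from PrimRec_Suc.prems obtain y' where
    "rec_eval (PrimRec f g) (n # xs) y'" "rec_eval g (n # y' # xs) z"
    by (rule rec_eval_PrimRec_SucE)
  with PrimRec_Suc.IH show ?case by metis
next
  case (Mu f n xs)
  have z1: "rec_eval f (z # xs) 0"
    using Mu.prems by (rule rec_eval_MuE)
  have z2: "\<exists>y. rec_eval f (i # xs) (Suc y)" if "i < z" for i
    using Mu.prems
  proof (rule rec_eval_MuE)
    assume "\<And>i. i < z \<Longrightarrow> \<exists>y. rec_eval f (i # xs) (Suc y)"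
    from this[OF that] show ?thesis .
  qed
  show ?case
  proof (rule linorder_cases[of n z])
    assume "n < z"
    from z2[OF this] obtain y where "rec_eval f (n # xs) (Suc y)" by (rule exE)
    from Mu.IH(1)[OF this] show ?thesis by simp
  next
    assume "z < n"
    from Mu.IH(2)[OF this] obtain y where "\<forall>z'. rec_eval f (z # xs) z' \<longrightarrow> Suc y = z'" by blast
    with z1 show ?thesis by auto
  qed
qed (erule rec_eval_ZeroE rec_eval_SuccE rec_eval_ProjE rec_eval_PrimRec_0E, simp)+

text \<open>Decidability of the property \<open>S\<close> of instances from \<open>I\<close>, presented through the encoding
  \<open>code\<close>. The algorithm must halt and answer correctly on instances; nothing is required of it on
  numbers that encode no instance.\<close>

definition decidable_on :: "('i \<Rightarrow> nat) \<Rightarrow> 'i set \<Rightarrow> 'i set \<Rightarrow> bool" where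
  "decidable_on code I S \<longleftrightarrow>
     (\<exists>f. \<forall>x\<in>I. rec_eval f [code x] (if x \<in> S then 1 else 0))"

section \<open>Encoding of instances\<close>

text \<open>Letters are natural numbers. A VAS is encoded by the table of its displacement function,
  listed by increasing letter, and its initial vector.\<close>

definition encode_vas :: "nat vas \<Rightarrow> nat" where
  "encode_vas V = prod_encode
     (list_encode (map (\<lambda>a. prod_encode (a, list_encode (map int_encode (disp V a))))
        (sorted_list_of_set (alphabet V))),
      list_encode (initial V))"

fun encode_vas_pair :: "nat vas \<times> nat vas \<Rightarrow> nat" where
  "encode_vas_pair (V1, V2) = prod_encode (encode_vas V1, encode_vas V2)"

lemma inj_on_encode_vas: "inj_on encode_vas {V. is_vas V}"
proof (rule inj_onI)
  fix V W :: "nat vas"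
  assume "V \<in> {V. is_vas V}" "W \<in> {V. is_vas V}" and eq: "encode_vas V = encode_vas W"
  then have V: "is_vas V" and W: "is_vas W" by auto
  let ?t = "\<lambda>V a. prod_encode (a, list_encode (map int_encode (disp V a)))"
  have init: "initial V = initial W"
    and tab: "map (?t V) (sorted_list_of_set (alphabet V)) =
              map (?t W) (sorted_list_of_set (alphabet W))"
    using eq by (simp_all add: encode_vas_def list_encode_eq)
  from arg_cong[OF tab, of "map (fst \<circ> prod_decode)"]
  have letters: "sorted_list_of_set (alphabet V) = sorted_list_of_set (alphabet W)"
    by (simp add: comp_def)
  then have alph: "alphabet V = alphabet W"
    using V W unfolding is_vas_def by (metis set_sorted_list_of_set)
  have disp: "disp V a = disp W a" if "a \<in> alphabet V" for a
  proof -
    have "a \<in> set (sorted_list_of_set (alphabet V))"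
      using that V by (simp add: is_vas_def)
    with tab[folded letters] have "?t V a = ?t W a"
      unfolding map_eq_conv by (rule bspec)
    then have "map int_encode (disp V a) = map int_encode (disp W a)"
      by (simp add: list_encode_eq)
    then show ?thesis
      by (rule map_injective[OF _ inj_int_encode])
  qed
  have "disp V \<in> alphabet V \<rightarrow>\<^sub>E {v. length v = dimension V}"
    "disp W \<in> alphabet V \<rightarrow>\<^sub>E {v. length v = dimension V}"
    using V W alph init by (simp_all add: is_vas_def dimension_def)
  then have "disp V = disp W"
    using disp by (rule PiE_ext)
  with init alph show "V = W" by simp
qed

text \<open>Dimension at least \<open>1\<close> is what \<open>{1} \<subseteq> {1..d}\<close> amounts to.\<close>

definition vas_pairs :: "(nat vas \<times> nat vas) set" where
  "vas_pairs = {(V1, V2). is_vas V1 \<and> is_vas V2 \<and>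
     dimension V1 = dimension V2 \<and> 1 \<le> dimension V1}"

end

theory Submission
  imports Defs
begin

text \<open>Suppose that \<open>f\<close> decides the problem. The program \<open>P\<close> reads four numbers, computes from them the
  code of a pair of VAS, runs \<open>f\<close> on this code and halts iff \<open>f\<close> answers that the two closures are equal.
  From any counter program one builds two VAS whose closures are equal iff the program does not
  halt, and the transitions of these VAS do not depend on the input of the program. Feeding \<open>P\<close> with
  the codes of the transition tables of its own two VAS (and with the lengths of two blocks of the
  initial vector) makes it ask \<open>f\<close> about this very pair, which is contradictory. No universal
  machine is needed.

  The VAS guess a bound \<open>K\<close>, kept in the coordinate that is compared exactly, and simulate the program
  with all registers bounded by \<open>K\<close> and with exactly \<open>K\<close> zero tests. A zero test contributes at most
  \<open>2 * K\<close> to a coordinate \<open>Y\<close>, and it contributes that much only if the tested register is zero. So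
  \<open>Y = 2 * K * K\<close> certifies a faithful run. Both VAS reach every \<open>Y \<le> 2 * K * K\<close> together with
  arbitrarily large values of the other counters, and only the first VAS can add \<open>1\<close> to \<open>Y\<close> when the
  program has halted.\<close>

section \<open>Computable functions\<close>

definition computable :: "nat \<Rightarrow> (nat list \<Rightarrow> nat) \<Rightarrow> bool" where
  "computable k F \<longleftrightarrow> (\<exists>f. \<forall>xs. length xs = k \<longrightarrow> rec_eval f xs (F xs))"

lemma computable_zero: "computable k (\<lambda>xs. 0)"
  unfolding computable_def by (auto intro: rec_eval.Zero)

lemma computable_nth: "i < k \<Longrightarrow> computable k (\<lambda>xs. xs ! i)"
  unfolding computable_def by (auto intro!: exI[of _ "Proj i"] rec_eval.Proj)

lemma computable_compose:
  assumes "computable (length Gs) F" "\<And>G. G \<in> set Gs \<Longrightarrow> computable k G"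
  shows "computable k (\<lambda>xs. F (map (\<lambda>G. G xs) Gs))"
proof -
  obtain f where f: "\<And>xs. length xs = length Gs \<Longrightarrow> rec_eval f xs (F xs)"
    using assms(1) unfolding computable_def by blast
  obtain h where h: "\<And>G xs. G \<in> set Gs \<Longrightarrow> length xs = k \<Longrightarrow> rec_eval (h G) xs (G xs)"
    using assms(2) unfolding computable_def by metis
  have "rec_eval (Comp f (map h Gs)) xs (F (map (\<lambda>G. G xs) Gs))" if "length xs = k" for xs
    by (rule rec_eval.Comp) (auto simp: list_all2_conv_all_nth h that intro!: f)
  then show ?thesis unfolding computable_def by blast
qed

lemma computable_compose1:
  assumes "computable 1 (\<lambda>ys. F (ys ! 0))" "computable k G"
  shows "computable k (\<lambda>xs. F (G xs))"
  using computable_compose[of "[G]" "\<lambda>ys. F (ys ! 0)" k] assms by simp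

lemma computable_compose2:
  assumes "computable 2 (\<lambda>ys. F (ys ! 0) (ys ! 1))" "computable k G" "computable k H"
  shows "computable k (\<lambda>xs. F (G xs) (H xs))"
  using computable_compose[of "[G, H]" "\<lambda>ys. F (ys ! 0) (ys ! 1)" k] assms
  by (auto simp: numeral_2_eq_2)

lemma computable_compose3:
  assumes "computable 3 (\<lambda>ys. F (ys ! 0) (ys ! 1) (ys ! 2))"
    "computable k G" "computable k H" "computable k I"
  shows "computable k (\<lambda>xs. F (G xs) (H xs) (I xs))"
  using computable_compose[of "[G, H, I]" "\<lambda>ys. F (ys ! 0) (ys ! 1) (ys ! 2)" k] assms
  by (auto simp: numeral_3_eq_3 numeral_2_eq_2)

text \<open>The arity is a variable \<open>l\<close> because numerals such as \<open>2\<close> or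
  \<open>3\<close> do not unify with \<open>Suc k\<close>.\<close>

lemma computable_primrec:
  assumes "computable k F" "computable (Suc (Suc k)) G" "l = Suc k"
  shows "computable l (\<lambda>xs. rec_nat (F (tl xs)) (\<lambda>n y. G (n # y # tl xs)) (hd xs))"
proof -
  obtain f g where f: "\<And>xs. length xs = k \<Longrightarrow> rec_eval f xs (F xs)"
    and g: "\<And>xs. length xs = Suc (Suc k) \<Longrightarrow> rec_eval g xs (G xs)"
    using assms unfolding computable_def by blast
  have "rec_eval (PrimRec f g) (n # ys) (rec_nat (F ys) (\<lambda>n y. G (n # y # ys)) n)"
    if "length ys = k" for n ys
    by (induction n) (auto intro!: rec_eval.PrimRec_0 rec_eval.PrimRec_Suc[rotated] f g simp: that)
  then show ?thesis
    unfolding computable_def \<open>l = Suc k\<close>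
    by (auto simp: length_Suc_conv intro!: exI[of _ "PrimRec f g"])
qed

lemma computable_cong:
  assumes "computable k F" "\<And>xs. length xs = k \<Longrightarrow> F xs = G xs"
  shows "computable k G"
  using assms unfolding computable_def by auto

lemma computable_Suc:
  assumes "computable k F"
  shows "computable k (\<lambda>xs. Suc (F xs))"
proof (rule computable_compose1[OF _ assms, of Suc])
  show "computable 1 (\<lambda>ys. Suc (ys ! 0))"
    unfolding computable_def
    by (auto simp: length_Suc_conv intro!: exI[of _ Succ] rec_eval.Succ)
qed

lemma computable_add:
  assumes "computable k F" "computable k G"
  shows "computable k (\<lambda>xs. F xs + G xs)"
proof (rule computable_compose2[OF _ assms, of "(+)"])
  \<comment> \<open>The step function finds the counter at index 0, the previous value at index 1
    and the parameters from index 2 on.\<close>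
  have step: "computable (Suc (Suc 1)) (\<lambda>xs. Suc (xs ! 1))"
    by (intro computable_Suc computable_nth) simp
  have eq: "rec_nat b (\<lambda>n. Suc) a = a + b" for a b :: nat
    by (induction a) auto
  show "computable 2 (\<lambda>ys. ys ! 0 + ys ! 1)"
    using computable_primrec[OF computable_nth[of 0 1] step, of 2, simplified]
    by (rule computable_cong) (auto simp: numeral_2_eq_2 length_Suc_conv eq)
qed

section \<open>Computability of the pairing function and of list codes\<close>

lemma computable_triangle:
  assumes "computable k F"
  shows "computable k (\<lambda>xs. triangle (F xs))"
proof (rule computable_compose1[OF _ assms, of triangle])
  have step: "computable (Suc (Suc 0)) (\<lambda>xs. xs ! 1 + Suc (xs ! 0))"
    by (intro computable_Suc computable_nth computable_add) simp_all
  have eq: "rec_nat 0 (\<lambda>n y. Suc (y + n)) a = triangle a" for a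
    by (induction a) auto
  show "computable 1 (\<lambda>ys. triangle (ys ! 0))"
    using computable_primrec[OF computable_zero step, of 1]
    by (auto simp: length_Suc_conv eq elim!: computable_cong)
qed

lemma computable_prod_encode:
  assumes "computable k F" "computable k G"
  shows "computable k (\<lambda>xs. prod_encode (F xs, G xs))"
  unfolding prod_encode_def by (simp, intro computable_add computable_triangle assms)

lemma computable_list_encode_Cons:
  assumes "computable k F" "computable k (\<lambda>xs. list_encode (G xs))"
  shows "computable k (\<lambda>xs. list_encode (F xs # G xs))"
  using computable_Suc[OF computable_prod_encode[OF assms]] by simp

text \<open>The length of the block is itself an argument, so the block arises by a primitive
  recursion whose step \<open>Suc (prod_encode (x, y))\<close> is the code of one cons.\<close>

lemma computable_list_encode_replicate_append:
  assumes "computable k N" "computable k F" "computable k (\<lambda>xs. list_encode (G xs))"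
  shows "computable k (\<lambda>xs. list_encode (replicate (N xs) (F xs) @ G xs))"
proof -
  let ?I = "\<lambda>n x z. ((\<lambda>y. Suc (prod_encode (x, y))) ^^ n) z"
  have step: "computable (Suc (Suc 2)) (\<lambda>xs. Suc (prod_encode (xs ! 2, xs ! 1)))"
    by (intro computable_Suc computable_nth computable_prod_encode) simp_all
  have eq: "rec_nat z (\<lambda>n y. Suc (prod_encode (x, y))) a = ?I a x z" for a x z
    by (induction a) auto
  have I: "computable 3 (\<lambda>ys. ?I (ys ! 0) (ys ! 1) (ys ! 2))"
    using computable_primrec[OF computable_nth[of 1 2] step, of 3, simplified]
    by (rule computable_cong)
      (auto simp: numeral_2_eq_2 numeral_3_eq_3 length_Suc_conv eq)
  have "?I n x (list_encode zs) = list_encode (replicate n x @ zs)" for n x zs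
    by (induction n) auto
  with computable_compose3[OF I assms] show ?thesis by simp
qed

section \<open>Counter programs\<close>

datatype act = Nop | Incr nat | Decr nat | IsZ nat

fun act_rel :: "act \<Rightarrow> (nat \<Rightarrow> nat) \<Rightarrow> (nat \<Rightarrow> nat) \<Rightarrow> bool" where
  "act_rel Nop s t \<longleftrightarrow> t = s"
| "act_rel (Incr r) s t \<longleftrightarrow> t = s(r := Suc (s r))"
| "act_rel (Decr r) s t \<longleftrightarrow> 0 < s r \<and> t = s(r := s r - 1)"
| "act_rel (IsZ r) s t \<longleftrightarrow> s r = 0 \<and> t = s"

definition mstep :: "('q \<times> act \<times> 'q) set \<Rightarrow> 'q \<times> (nat \<Rightarrow> nat) \<Rightarrow> 'q \<times> (nat \<Rightarrow> nat) \<Rightarrow> bool" where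
  "mstep D x y \<longleftrightarrow> (\<exists>a. (fst x, a, fst y) \<in> D \<and> act_rel a (snd x) (snd y))"

datatype com = Skip | Act act | Seq com com | While nat com

text \<open>\<open>While r c\<close> decrements \<open>r\<close> at the beginning of each round.\<close>

inductive cstep :: "com \<Rightarrow> act \<Rightarrow> com \<Rightarrow> bool" where
  Act: "cstep (Act a) a Skip"
| Seq: "cstep c a c' \<Longrightarrow> cstep (Seq c d) a (Seq c' d)"
| Seq_Skip: "cstep (Seq Skip d) Nop d"
| While_zero: "cstep (While r c) (IsZ r) Skip"
| While_pos: "cstep (While r c) (Decr r) (Seq c (While r c))"

inductive_cases cstep_SkipE: "cstep Skip a c"
inductive_cases cstep_ActE: "cstep (Act b) a c"
inductive_cases cstep_SeqE: "cstep (Seq c d) a e"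
inductive_cases cstep_WhileE: "cstep (While r c) a e"

abbreviation prog_step :: "com \<times> (nat \<Rightarrow> nat) \<Rightarrow> com \<times> (nat \<Rightarrow> nat) \<Rightarrow> bool" where
  "prog_step \<equiv> mstep {(c, a, c'). cstep c a c'}"

lemma act_rel_functional: "act_rel a s t \<Longrightarrow> act_rel a s u \<Longrightarrow> t = u"
  by (cases a) auto

text \<open>The syntax leaves a choice only at a loop, and its two actions \<open>IsZ r\<close> and
  \<open>Decr r\<close> are never both enabled in one store. This is why stores enter the
  statement.\<close>

lemma cstep_deterministic:
  "cstep c a c' \<Longrightarrow> cstep c b c'' \<Longrightarrow> act_rel a s t \<Longrightarrow> act_rel b s u \<Longrightarrow> a = b \<and> c' = c'' \<and> t = u"
proof (induction arbitrary: b c'' rule: cstep.induct)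
  case (Act a)
  from Act.prems(1) have "b = a" "c'' = Skip" by (rule cstep_ActE, simp)+
  with act_rel_functional Act.prems(2,3) show ?case by blast
next
  case (Seq c a c' d)
  from Seq.prems(1) show ?case
    by (rule cstep_SeqE) (use Seq in \<open>auto elim: cstep_SkipE\<close>)
next
  case (Seq_Skip d)
  from Seq_Skip.prems(1) show ?case
    by (rule cstep_SeqE) (use Seq_Skip in \<open>auto elim: cstep_SkipE\<close>)
next
  case (While_zero r c)
  from While_zero.prems(1) show ?case
    by (rule cstep_WhileE) (use While_zero.prems in auto)
next
  case (While_pos r c)
  from While_pos.prems(1) show ?case
    by (rule cstep_WhileE) (use While_pos in auto)
qed

lemma prog_step_deterministic: "prog_step x y \<Longrightarrow> prog_step x z \<Longrightarrow> y = z"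
proof -
  assume "prog_step x y" "prog_step x z"
  then obtain a b where "cstep (fst x) a (fst y)" "act_rel a (snd x) (snd y)"
    "cstep (fst x) b (fst z)" "act_rel b (snd x) (snd z)"
    unfolding mstep_def by blast
  from cstep_deterministic[OF this(1,3,2,4)] show ?thesis by (simp add: prod_eq_iff)
qed

text \<open>Used for divergence: a run that blocks before \<open>Skip\<close> excludes every run
  that ends in \<open>Skip\<close>.\<close>

lemma deterministic_stuck_unique:
  assumes det: "\<And>x y z. r x y \<Longrightarrow> r x z \<Longrightarrow> y = z"
    and "r\<^sup>*\<^sup>* x y" "r\<^sup>*\<^sup>* x z" "\<And>w. \<not> r y w" "\<And>w. \<not> r z w"
  shows "y = z"
  using assms(2-)
proof (induction arbitrary: z rule: converse_rtranclp_induct)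
  case base
  then show ?case by (auto elim: converse_rtranclpE)
next
  case (step x x')
  from step.hyps(1) step.prems(3) have "x \<noteq> z" by auto
  with step.prems(1) obtain w where "r x w" "r\<^sup>*\<^sup>* w z" by (auto elim: converse_rtranclpE)
  then have "r\<^sup>*\<^sup>* x' z" using det[OF step.hyps(1)] by simp
  from step.IH[OF this step.prems(2,3)] show ?case .
qed

definition runs :: "com \<Rightarrow> (nat \<Rightarrow> nat) \<Rightarrow> (nat \<Rightarrow> nat) \<Rightarrow> bool" where
  "runs c s t \<longleftrightarrow> prog_step\<^sup>*\<^sup>* (c, s) (Skip, t)"

lemma runs_Skip: "runs Skip s s"
  by (simp add: runs_def)

lemma runs_Act: "act_rel a s t \<Longrightarrow> runs (Act a) s t"
  unfolding runs_def by (rule r_into_rtranclp) (auto simp: mstep_def intro: cstep.Act)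

text \<open>The target is the entry of \<open>d\<close> and not the end of the sequence, so that the
  lemma also applies when \<open>d\<close> blocks.\<close>

lemma prog_steps_Seq:
  assumes "runs c s t"
  shows "prog_step\<^sup>*\<^sup>* (Seq c d, s) (d, t)"
proof -
  have "prog_step\<^sup>*\<^sup>* x y \<Longrightarrow> prog_step\<^sup>*\<^sup>* (Seq (fst x) d, snd x) (Seq (fst y) d, snd y)" for x y
  proof (induction rule: rtranclp_induct)
    case (step y z)
    then have "prog_step (Seq (fst y) d, snd y) (Seq (fst z) d, snd z)"
      by (auto simp: mstep_def intro: cstep.Seq)
    with step.IH show ?case by (rule rtranclp.rtrancl_into_rtrancl)
  qed simp
  from this[OF assms[unfolded runs_def]] have "prog_step\<^sup>*\<^sup>* (Seq c d, s) (Seq Skip d, t)" by simp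
  moreover have "prog_step (Seq Skip d, t) (d, t)"
    by (auto simp: mstep_def intro: cstep.Seq_Skip exI[of _ Nop])
  ultimately show ?thesis by (rule rtranclp.rtrancl_into_rtrancl)
qed

lemma runs_Seq: "runs c s t \<Longrightarrow> runs d t u \<Longrightarrow> runs (Seq c d) s u"
  using prog_steps_Seq unfolding runs_def by (rule rtranclp_trans)

lemma runs_While_zero: "s r = 0 \<Longrightarrow> runs (While r c) s s"
  unfolding runs_def
  by (rule r_into_rtranclp) (auto simp: mstep_def intro!: exI[of _ "IsZ r"] cstep.While_zero)

lemma runs_While_pos:
  assumes "0 < s r" "runs c (s(r := s r - 1)) t" "runs (While r c) t u"
  shows "runs (While r c) s u"
proof -
  have "prog_step (While r c, s) (Seq c (While r c), s(r := s r - 1))"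
    using assms(1) by (auto simp: mstep_def intro!: exI[of _ "Decr r"] cstep.While_pos)
  with runs_Seq[OF assms(2,3)] show ?thesis
    unfolding runs_def by (rule converse_rtranclp_into_rtranclp[rotated])
qed

section \<open>Clearing, moving and copying registers\<close>

abbreviation clear :: "nat \<Rightarrow> com" where
  "clear r \<equiv> While r Skip"

fun clears :: "nat list \<Rightarrow> com" where
  "clears [] = Skip"
| "clears (r # rs) = Seq (clear r) (clears rs)"

definition move :: "nat \<Rightarrow> nat \<Rightarrow> com" where
  "move r p = While r (Act (Incr p))"

text \<open>Reading a register by a loop destroys it; the second copy in \<open>t\<close> restores
  it.\<close>

definition copy :: "nat \<Rightarrow> nat \<Rightarrow> nat \<Rightarrow> com" where
  "copy r p t = Seq (While r (Seq (Act (Incr p)) (Act (Incr t)))) (move t r)"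

lemma runs_clear: "runs (clear r) s (s(r := 0))"
proof (induction "s r" arbitrary: s)
  case 0
  then show ?case using runs_While_zero[of s r Skip] by (simp add: fun_upd_idem)
next
  case (Suc n)
  have "runs (clear r) (s(r := s r - 1)) ((s(r := s r - 1))(r := 0))"
    by (rule Suc.hyps) (simp flip: Suc.hyps(2))
  then show ?case using Suc.hyps(2) by (auto intro: runs_While_pos runs_Skip)
qed

lemma runs_clears: "runs (clears rs) s (\<lambda>r. if r \<in> set rs then 0 else s r)"
proof (induction rs arbitrary: s)
  case Nil
  then show ?case by (simp add: runs_Skip)
next
  case (Cons r rs)
  have "(\<lambda>i. if i \<in> set rs then 0 else (s(r := 0)) i) =
      (\<lambda>i. if i \<in> set (r # rs) then 0 else s i)"
    by auto
  with runs_Seq[OF runs_clear Cons.IH[of "s(r := 0)"]] show ?case by simp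
qed

lemma runs_move:
  assumes "r \<noteq> p"
  shows "runs (move r p) s (s(r := 0, p := s p + s r))"
proof (induction "s r" arbitrary: s)
  case 0
  then have "s(r := 0, p := s p + s r) = s" by auto
  with runs_While_zero[of s r] 0 show ?case unfolding move_def by metis
next
  case (Suc n)
  let ?t = "s(r := s r - 1, p := Suc (s p))"
  have "runs (move r p) ?t (?t(r := 0, p := ?t p + ?t r))"
    by (rule Suc.hyps) (use assms in \<open>simp flip: Suc.hyps(2)\<close>)
  moreover have "?t(r := 0, p := ?t p + ?t r) = s(r := 0, p := s p + s r)"
    using assms Suc.hyps(2) by auto
  moreover have "runs (Act (Incr p)) (s(r := s r - 1)) ?t"
    using assms by (intro runs_Act) auto
  ultimately show ?case
    unfolding move_def using Suc.hyps(2) by (intro runs_While_pos[of s r]) auto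
qed

lemma runs_copy:
  assumes "r \<noteq> p" "r \<noteq> t" "p \<noteq> t" "s t = 0"
  shows "runs (copy r p t) s (s(p := s p + s r))"
proof -
  let ?b = "Seq (Act (Incr p)) (Act (Incr t))"
  \<comment> \<open>The loop is treated for an arbitrary \<open>s t\<close>, since the scratch
    register is no longer zero after the first round.\<close>
  have loop: "runs (While r ?b) s (s(r := 0, p := s p + s r, t := s t + s r))" for s
  proof (induction "s r" arbitrary: s)
    case 0
    then have "s(r := 0, p := s p + s r, t := s t + s r) = s" by auto
    with runs_While_zero[of s r] 0 show ?case by metis
  next
    case (Suc n)
    let ?u = "s(r := s r - 1, p := Suc (s p), t := Suc (s t))"
    have "runs (While r ?b) ?u (?u(r := 0, p := ?u p + ?u r, t := ?u t + ?u r))"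
      by (rule Suc.hyps) (use assms in \<open>simp flip: Suc.hyps(2)\<close>)
    moreover have "?u(r := 0, p := ?u p + ?u r, t := ?u t + ?u r) =
        s(r := 0, p := s p + s r, t := s t + s r)"
      using assms Suc.hyps(2) by auto
    moreover have "runs ?b (s(r := s r - 1)) ?u"
      using assms by (intro runs_Seq[OF runs_Act runs_Act]) auto
    ultimately show ?case
      using Suc.hyps(2) by (intro runs_While_pos[of s r]) auto
  qed
  let ?u = "s(r := 0, p := s p + s r, t := s t + s r)"
  have "?u(t := 0, r := ?u r + ?u t) = s(p := s p + s r)"
    using assms by auto
  with runs_Seq[OF loop[of s] runs_move[of t r ?u]] assms show ?thesis
    unfolding copy_def by simp
qed

text \<open>\<open>compile f is p n\<close> stores the value of \<open>f\<close> at the registers \<open>is\<close> in register \<open>p\<close>. The registers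
  from \<open>n\<close> on are scratch; they are zero before and after.\<close>

fun compile :: "recf \<Rightarrow> nat list \<Rightarrow> nat \<Rightarrow> nat \<Rightarrow> com"
  and compiles :: "recf list \<Rightarrow> nat list \<Rightarrow> nat \<Rightarrow> nat \<Rightarrow> com" where
  "compile Zero is p n = Skip"
| "compile Succ is p n = Seq (copy (hd is) p n) (Act (Incr p))"
| "compile (Proj i) is p n = copy (is ! i) p n"
| "compile (Comp f gs) is p n =
    (let js = [n..<n + length gs]; n' = n + length gs in
     Seq (compiles gs is n n') (Seq (compile f js p n') (clears js)))"
| "compile (PrimRec f g) is p n =
    Seq (copy (hd is) (n + 2) n) (Seq (compile f (tl is) (n + 1) (n + 4))
     (Seq (While (n + 2)
        (Seq (compile g (n # (n + 1) # tl is) (n + 3) (n + 4))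
          (Seq (clear (n + 1)) (Seq (move (n + 3) (n + 1)) (Act (Incr n))))))
     (Seq (move (n + 1) p) (clear n))))"
| "compile (Mu f) is p n =
    Seq (compile f (n # is) (n + 1) (n + 2))
     (Seq (While (n + 1)
        (Seq (clear (n + 1)) (Seq (Act (Incr n)) (compile f (n # is) (n + 1) (n + 2)))))
     (move n p))"
| "compiles [] is j n = Skip"
| "compiles (g # gs) is j n = Seq (compile g is j n) (compiles gs is (Suc j) n)"

text \<open>Runs for defined values are enough: that a program fails to halt will follow from the
  defined answer 0 and determinism.\<close>

definition compile_correct :: "recf \<Rightarrow> bool" where
  "compile_correct f \<longleftrightarrow> (\<forall>is p n s y. rec_eval f (map s is) y \<longrightarrow> (\<forall>i\<in>set is. i < n) \<longrightarrow>
     p < n \<longrightarrow> p \<notin> set is \<longrightarrow> s p = 0 \<longrightarrow> (\<forall>r\<ge>n. s r = 0) \<longrightarrow>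
     runs (compile f is p n) s (s(p := y)))"

lemma compile_correctI:
  assumes "\<And>is p n s y. rec_eval f (map s is) y \<Longrightarrow> \<forall>i\<in>set is. i < n \<Longrightarrow>
     p < n \<Longrightarrow> p \<notin> set is \<Longrightarrow> s p = 0 \<Longrightarrow> \<forall>r\<ge>n. s r = 0 \<Longrightarrow>
     runs (compile f is p n) s (s(p := y))"
  shows "compile_correct f"
  using assms unfolding compile_correct_def by blast

lemma compile_correctD:
  assumes "compile_correct f" "rec_eval f xs y" "xs = map s is" "\<And>i. i \<in> set is \<Longrightarrow> i < n"
    "p < n" "p \<notin> set is" "s p = 0" "\<And>r. r \<ge> n \<Longrightarrow> s r = 0" "t = s(p := y)"
  shows "runs (compile f is p n) s t"
  using assms unfolding compile_correct_def by blast

section \<open>Correctness of the compiler, construct by construct\<close>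

lemma runs_compiles:
  assumes "\<And>g. g \<in> set gs \<Longrightarrow> compile_correct g"
    "list_all2 (\<lambda>g y. rec_eval g (map s is) y) gs ys"
    "\<And>i. i \<in> set is \<Longrightarrow> i < j" "j + length gs \<le> n" "\<And>r. r \<ge> j \<Longrightarrow> s r = 0"
  shows "runs (compiles gs is j n) s
    (\<lambda>r. if j \<le> r \<and> r < j + length gs then ys ! (r - j) else s r)"
  using assms
proof (induction gs arbitrary: ys j s)
  case Nil
  have eq: "(\<lambda>r. if j \<le> r \<and> r < j + length [] then ys ! (r - j) else s r) = s" by auto
  show ?case unfolding eq by (simp add: runs_Skip)
next
  case (Cons g gs)
  from Cons.prems(2) obtain y ys' where ys: "ys = y # ys'" "rec_eval g (map s is) y"
    "list_all2 (\<lambda>g y. rec_eval g (map s is) y) gs ys'"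
    by (auto simp: list_all2_Cons1)
  let ?s = "s(j := y)"
  have s: "map ?s is = map s is"
    using Cons.prems(3) by auto
  \<comment> \<open>The results go to registers from \<open>j\<close> up, all below
    \<open>n\<close>, so every call finds the scratch area from \<open>n\<close> on still
    zero.\<close>
  have 1: "runs (compile g is j n) s ?s"
    by (rule compile_correctD[OF _ ys(2)]) (use Cons.prems(1,4,5) Cons.prems(3)[of j] in
        \<open>auto dest: Cons.prems(3)\<close>)
  have 2: "runs (compiles gs is (Suc j) n) ?s
    (\<lambda>r. if Suc j \<le> r \<and> r < Suc j + length gs then ys' ! (r - Suc j) else ?s r)"
  proof (rule Cons.IH)
    show "list_all2 (\<lambda>g. rec_eval g (map ?s is)) gs ys'" using ys(3) s by metis
    show "i < Suc j" if "i \<in> set is" for i using Cons.prems(3)[OF that] by simp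
    show "compile_correct g" if "g \<in> set gs" for g using Cons.prems(1) that by simp
    show "Suc j + length gs \<le> n" using Cons.prems(4) by simp
    show "?s r = 0" if "Suc j \<le> r" for r using Cons.prems(5)[of r] that by simp
  qed
  have "(\<lambda>r. if Suc j \<le> r \<and> r < Suc j + length gs then ys' ! (r - Suc j) else ?s r) =
    (\<lambda>r. if j \<le> r \<and> r < j + length (g # gs) then ys ! (r - j) else s r)"
    by (auto simp: ys(1) fun_eq_iff nth_Cons' dest: le_antisym)
  with runs_Seq[OF 1 2] show ?case by simp
qed

text \<open>The value at \<open>n\<close> is obtained through the values at all smaller arguments.
  This supplies the starting value and the value after each round of the loop.\<close>

lemma rec_eval_PrimRec_le:
  "rec_eval (PrimRec f g) (n # xs) y \<Longrightarrow> m \<le> n \<Longrightarrow> \<exists>z. rec_eval (PrimRec f g) (m # xs) z"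
proof (induction n arbitrary: y)
  case (Suc n)
  then show ?case by (auto simp: le_Suc_eq elim: rec_eval_PrimRec_SucE)
qed auto

lemma compile_correct_Comp:
  assumes f: "compile_correct f" and gs: "\<And>g. g \<in> set gs \<Longrightarrow> compile_correct g"
  shows "compile_correct (Comp f gs)"
proof (rule compile_correctI)
  fix "is" :: "nat list" and p n :: nat and s :: "nat \<Rightarrow> nat" and y
  assume "rec_eval (Comp f gs) (map s is) y" and "is": "\<forall>i\<in>set is. i < n"
    and p: "p < n" "p \<notin> set is" "s p = 0" and n: "\<forall>r\<ge>n. s r = 0"
  then obtain ys where ys: "list_all2 (\<lambda>g y. rec_eval g (map s is) y) gs ys" "rec_eval f ys y"
    by (auto elim: rec_eval_CompE)
  then have len: "length gs = length ys" by (simp add: list_all2_lengthD)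
  let ?n = "n + length gs"
  let ?s = "\<lambda>r. if n \<le> r \<and> r < ?n then ys ! (r - n) else s r"
  have 1: "runs (compiles gs is n ?n) s ?s"
    using runs_compiles[OF gs ys(1)] "is" n by auto
  have 2: "runs (compile f [n..<?n] p ?n) ?s (?s(p := y))"
    by (rule compile_correctD[OF f ys(2)]) (use p n len in \<open>auto intro: nth_equalityI\<close>)
  have "(\<lambda>r. if r \<in> set [n..<?n] then 0 else (?s(p := y)) r) = s(p := y)"
    using p n by auto
  with runs_clears[of "[n..<?n]" "?s(p := y)"]
  have 3: "runs (clears [n..<?n]) (?s(p := y)) (s(p := y))" by (rule back_subst[of "runs _ _"])
  show "runs (compile (Comp f gs) is p n) s (s(p := y))"
    using runs_Seq[OF 1 runs_Seq[OF 2 3]] by (simp add: Let_def)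
qed

lemma compile_correct_PrimRec:
  assumes f: "compile_correct f" and g: "compile_correct g"
  shows "compile_correct (PrimRec f g)"
proof (rule compile_correctI)
  fix "is" :: "nat list" and p n :: nat and s :: "nat \<Rightarrow> nat" and y
  assume ev: "rec_eval (PrimRec f g) (map s is) y" and "is": "\<forall>i\<in>set is. i < n"
    and p: "p < n" "p \<notin> set is" "s p = 0" and n: "\<forall>r\<ge>n. s r = 0"
  from ev have "is \<noteq> []" by (auto elim: rec_eval.cases)
  then obtain c js where c: "is = c # js" by (cases "is") auto
  let ?xs = "map s js"
  \<comment> \<open>Register \<open>n\<close> counts finished rounds, \<open>n + 1\<close> holds the
    current value and \<open>n + 2\<close> the rounds left. The new value goes to
    \<open>n + 3\<close> first, since a compiled call may not write to a register it reads.\<close>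
  let ?st = "\<lambda>i acc rem. s(n := i, n + 1 := acc, n + 2 := rem)"
  have js: "map (s(n := i, n + 1 := acc, n + 2 := rem)) js = ?xs" for i acc rem
    using "is" c by auto
  let ?body = "Seq (compile g (n # (n + 1) # js) (n + 3) (n + 4))
          (Seq (clear (n + 1)) (Seq (move (n + 3) (n + 1)) (Act (Incr n))))"
  have loop: "runs (While (n + 2) ?body) (?st j z d) (?st (j + d) y 0)"
    if "rec_eval (PrimRec f g) (j # ?xs) z" "rec_eval (PrimRec f g) ((j + d) # ?xs) y" for j z d
    using that
  proof (induction d arbitrary: j z)
    case 0
    then have "z = y" by (auto dest: rec_eval_deterministic)
    then show ?case by (auto intro: runs_While_zero)
  next
    case (Suc d)
    obtain w where w: "rec_eval (PrimRec f g) (Suc j # ?xs) w"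
      using rec_eval_PrimRec_le[OF Suc.prems(2), of "Suc j"] by auto
    then have gw: "rec_eval g (j # z # ?xs) w"
      using rec_eval_deterministic[OF Suc.prems(1)] by (auto elim!: rec_eval_PrimRec_SucE)
    let ?u = "(?st j z d)(n + 3 := w)"
    have 1: "runs (compile g (n # (n + 1) # js) (n + 3) (n + 4)) (?st j z d) ?u"
      by (rule compile_correctD[OF g gw]) (use "is" n c js in auto)
    have 2: "runs (clear (n + 1)) ?u (?u(n + 1 := 0))" by (rule runs_clear)
    have 3: "runs (move (n + 3) (n + 1)) (?u(n + 1 := 0)) (?st j w d)"
      using runs_move[of "n + 3" "n + 1" "?u(n + 1 := 0)"] n
      by (auto elim!: back_subst[of "runs _ _"])
    have 4: "runs (Act (Incr n)) (?st j w d) (?st (Suc j) w d)"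
      by (rule runs_Act) auto
    have st: "(?st j z (Suc d))(n + 2 := ?st j z (Suc d) (n + 2) - 1) = ?st j z d" by auto
    show ?case
    proof (rule runs_While_pos)
      show "0 < ?st j z (Suc d) (n + 2)" by simp
      show "runs ?body ((?st j z (Suc d))(n + 2 := ?st j z (Suc d) (n + 2) - 1)) (?st (Suc j) w d)"
        unfolding st by (rule runs_Seq[OF 1 runs_Seq[OF 2 runs_Seq[OF 3 4]]])
      show "runs (While (n + 2) ?body) (?st (Suc j) w d) (?st (j + Suc d) y 0)"
        using Suc.IH[OF w] Suc.prems(2) unfolding add_Suc_shift by blast
    qed
  qed
  have ev: "rec_eval (PrimRec f g) (s c # ?xs) y" using ev c by simp
  then obtain z where z: "rec_eval (PrimRec f g) (0 # ?xs) z"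
    using rec_eval_PrimRec_le[of f g "s c" _ y 0] by auto
  then have fz: "rec_eval f ?xs z" by (auto elim: rec_eval_PrimRec_0E)
  have 1: "runs (copy (hd is) (n + 2) n) s (?st 0 0 (s c))"
    using runs_copy[of c "n + 2" n s] "is" c n by (auto elim!: back_subst[of "runs _ _"])
  have 2: "runs (compile f js (n + 1) (n + 4)) (?st 0 0 (s c)) (?st 0 z (s c))"
    by (rule compile_correctD[OF f fz]) (use "is" n c js in auto)
  have 3: "runs (While (n + 2) ?body) (?st 0 z (s c)) (?st (s c) y 0)"
    using loop[OF z, of "s c"] ev by simp
  have 4: "runs (move (n + 1) p) (?st (s c) y 0) (s(n := s c, p := y))"
    using runs_move[of "n + 1" p "?st (s c) y 0"] p n by (auto elim!: back_subst[of "runs _ _"])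
  have 5: "runs (clear n) (s(n := s c, p := y)) (s(p := y))"
    using runs_clear[of n "s(n := s c, p := y)"] p n by (auto elim!: back_subst[of "runs _ _"])
  show "runs (compile (PrimRec f g) is p n) s (s(p := y))"
    using runs_Seq[OF 1 runs_Seq[OF 2 runs_Seq[OF 3 runs_Seq[OF 4 5]]]] c by simp
qed

lemma compile_correct_Mu:
  assumes f: "compile_correct f"
  shows "compile_correct (Mu f)"
proof (rule compile_correctI)
  fix "is" :: "nat list" and p n :: nat and s :: "nat \<Rightarrow> nat" and y
  assume ev: "rec_eval (Mu f) (map s is) y" and "is": "\<forall>i\<in>set is. i < n"
    and p: "p < n" "p \<notin> set is" "s p = 0" and n: "\<forall>r\<ge>n. s r = 0"
  let ?xs = "map s is"
  let ?st = "\<lambda>i v. s(n := i, n + 1 := v)"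
  have js: "map (s(n := i)) is = ?xs" for i
    using "is" by auto
  from ev have y: "rec_eval f (y # ?xs) 0"
    and less_y: "\<And>i. i < y \<Longrightarrow> \<exists>v. rec_eval f (i # ?xs) (Suc v)"
    by (auto elim: rec_eval_MuE)
  have call: "runs (compile f (n # is) (n + 1) (n + 2)) (s(n := i)) (?st i v)"
    if "rec_eval f (i # ?xs) v" for i v
    by (rule compile_correctD[OF f that]) (use "is" n js in auto)
  let ?body = "Seq (clear (n + 1)) (Seq (Act (Incr n)) (compile f (n # is) (n + 1) (n + 2)))"
  \<comment> \<open>\<open>v\<close> is the value of \<open>f\<close> at the candidate
    \<open>i\<close>, and \<open>d\<close> the distance to the least zero \<open>y\<close>. Below
    \<open>y\<close> the value is a successor, so the loop is entered; at \<open>y\<close> it is 0,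
    so the loop exits with register \<open>n + 1\<close> already zero.\<close>
  have loop: "runs (While (n + 1) ?body) (?st i v) (s(n := y))"
    if "rec_eval f (i # ?xs) v" "i + d = y" for i v d
    using that
  proof (induction d arbitrary: i v)
    case 0
    then have "v = 0" using y by (auto dest: rec_eval_deterministic)
    then have eq: "?st i v = s(n := y)" using n 0 by auto
    show ?case unfolding eq using n by (auto intro!: runs_While_zero)
  next
    case (Suc d)
    then obtain v' where "rec_eval f (i # ?xs) (Suc v')" using less_y[of i] by auto
    then have v: "v = Suc v'" using Suc.prems(1) by (auto dest: rec_eval_deterministic)
    obtain w where w: "rec_eval f (Suc i # ?xs) w"
      using less_y[of "Suc i"] y Suc.prems(2) by (cases d) auto
    have 1: "runs (clear (n + 1)) (?st i v') (s(n := i))"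
      using runs_clear[of "n + 1" "?st i v'"] n by (auto elim!: back_subst[of "runs _ _"])
    have 2: "runs (Act (Incr n)) (s(n := i)) (s(n := Suc i))"
      by (rule runs_Act) auto
    have st: "(?st i v)(n + 1 := ?st i v (n + 1) - 1) = ?st i v'" using v by auto
    show ?case
    proof (rule runs_While_pos)
      show "0 < ?st i v (n + 1)" using v by simp
      show "runs ?body ((?st i v)(n + 1 := ?st i v (n + 1) - 1)) (?st (Suc i) w)"
        unfolding st by (rule runs_Seq[OF 1 runs_Seq[OF 2 call[OF w]]])
      show "runs (While (n + 1) ?body) (?st (Suc i) w) (s(n := y))"
        using Suc.IH[OF w] Suc.prems(2) unfolding add_Suc_shift by blast
    qed
  qed
  obtain v where v: "rec_eval f (0 # ?xs) v" using less_y[of 0] y by (cases y) auto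
  have "s(n := 0) = s" using n by auto
  then have 1: "runs (compile f (n # is) (n + 1) (n + 2)) s (?st 0 v)" using call[OF v] by simp
  have 2: "runs (While (n + 1) ?body) (?st 0 v) (s(n := y))" using loop[OF v, of y] by simp
  have 3: "runs (move n p) (s(n := y)) (s(p := y))"
    using runs_move[of n p "s(n := y)"] p n by (auto elim!: back_subst[of "runs _ _"])
  show "runs (compile (Mu f) is p n) s (s(p := y))"
    using runs_Seq[OF 1 runs_Seq[OF 2 3]] by simp
qed

lemma compile_correct: "compile_correct f"
proof (induction f)
  case Zero
  show ?case
    unfolding compile_correct_def
    by (auto elim!: rec_eval_ZeroE simp: runs_Skip fun_upd_idem)
next
  case Succ
  show ?case
  proof (rule compile_correctI)
    fix "is" :: "nat list" and p n :: nat and s :: "nat \<Rightarrow> nat" and y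
    assume "rec_eval Succ (map s is) y" and "is": "\<forall>i\<in>set is. i < n"
      and p: "p < n" "p \<notin> set is" "s p = 0" and n: "\<forall>r\<ge>n. s r = 0"
    then obtain c where c: "is = [c]" "y = Suc (s c)" by (auto elim!: rec_eval_SuccE)
    have "runs (copy c p n) s (s(p := s c))"
      using runs_copy[of c p n s] "is" p n c by auto
    moreover have "runs (Act (Incr p)) (s(p := s c)) (s(p := y))"
      by (rule runs_Act) (auto simp: c)
    ultimately show "runs (compile Succ is p n) s (s(p := y))"
      using c by (auto intro: runs_Seq)
  qed
next
  case (Proj i)
  show ?case
  proof (rule compile_correctI)
    fix "is" :: "nat list" and p n :: nat and s :: "nat \<Rightarrow> nat" and y
    assume "rec_eval (Proj i) (map s is) y" and "is": "\<forall>i\<in>set is. i < n"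
      and p: "p < n" "p \<notin> set is" "s p = 0" and n: "\<forall>r\<ge>n. s r = 0"
    then have i: "i < length is" "y = s (is ! i)" by (auto elim!: rec_eval_ProjE)
    then have "is ! i \<noteq> p" "is ! i \<noteq> n" using "is" p(2) by (metis less_irrefl nth_mem)+
    then show "runs (compile (Proj i) is p n) s (s(p := y))"
      using runs_copy[of "is ! i" p n s] "is" p n i(2) by auto
  qed
next
  case (Comp f gs)
  then show ?case by (rule compile_correct_Comp)
next
  case (PrimRec f g)
  then show ?case by (rule compile_correct_PrimRec)
next
  case (Mu f)
  then show ?case by (rule compile_correct_Mu)
qed

section \<open>Simulation with a budget of zero tests\<close>

definition effect :: "('c \<Rightarrow> int) \<Rightarrow> ('c \<Rightarrow> nat) \<Rightarrow> ('c \<Rightarrow> nat) \<Rightarrow> bool" where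
  "effect d v w \<longleftrightarrow> (\<forall>c. int (w c) = int (v c) + d c)"

text \<open>A named constant, so that the simp rules below can strip the updates of a displacement
  such as \<open>zero_vec(X i := 1, Xb i := -1)\<close> one by one and turn them into updates of the
  vector.\<close>

definition zero_vec :: "'c \<Rightarrow> int" where
  "zero_vec = (\<lambda>_. 0)"

lemma zero_vec_apply [simp]: "zero_vec c = 0"
  by (simp add: zero_vec_def)

lemma effect_zero_vec [simp]: "effect zero_vec v w \<longleftrightarrow> w = v"
  by (auto simp: effect_def)

lemma effect_upd_one [simp]:
  assumes "d c = 0"
  shows "effect (d(c := 1)) v w \<longleftrightarrow> effect d (v(c := Suc (v c))) w"
  using assms unfolding effect_def by (intro iff_allI) auto

lemma effect_upd_minus_one [simp]:
  assumes "d c = 0"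
  shows "effect (d(c := -1)) v w \<longleftrightarrow> 0 < v c \<and> effect d (v(c := v c - 1)) w"
proof
  assume e: "effect (d(c := -1)) v w"
  then have "int (w c) = int (v c) - 1" by (auto simp: effect_def)
  then have "0 < v c" "w c = v c - 1" by auto
  with e assms show "0 < v c \<and> effect d (v(c := v c - 1)) w"
    by (auto simp: effect_def)
next
  assume "0 < v c \<and> effect d (v(c := v c - 1)) w"
  with assms show "effect (d(c := -1)) v w"
    unfolding effect_def by (auto split: if_splits)
qed

text \<open>\<open>K\<close> is the coordinate that the order compares exactly; it bounds the registers, and the
  register \<open>i\<close> is held in \<open>X i\<close> with \<open>X i + Xb i = K\<close>. \<open>T\<close> is the number of zero tests that are
  still available, and \<open>Y\<close> counts the units moved by zero tests.\<close>

datatype coord = K | Y | T | X nat | Xb nat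

text \<open>\<open>Z1 i q\<close> and \<open>Z2 i q\<close> are the two halves of a zero test of
  register \<open>i\<close> that continues in state \<open>q\<close>.\<close>

datatype 'q loc = Guess | At 'q | Z1 nat 'q | Z2 nat 'q | Fin

type_synonym 'q trans = "'q loc \<times> (coord \<Rightarrow> int) \<times> 'q loc"

text \<open>Raising the bound \<open>K\<close> raises the budget \<open>T\<close> and each
  complement \<open>Xb i\<close> as well, which preserves \<open>T = K\<close> and
  \<open>X i + Xb i = K\<close>.\<close>

definition guess_vec :: "nat \<Rightarrow> coord \<Rightarrow> int" where
  "guess_vec m c = (case c of K \<Rightarrow> 1 | T \<Rightarrow> 1 | Xb i \<Rightarrow> if i < m then 1 else 0 | _ \<Rightarrow> 0)"

text \<open>Every counter except \<open>K\<close> and \<open>Y\<close> is pumped, so that domination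
  between vectors at \<open>Fin\<close> comes down to \<open>K\<close> and \<open>Y\<close>.\<close>

definition flush_vec :: "nat \<Rightarrow> coord \<Rightarrow> int" where
  "flush_vec m c = (case c of T \<Rightarrow> 1 | X i \<Rightarrow> if i < m then 1 else 0
     | Xb i \<Rightarrow> if i < m then 1 else 0 | _ \<Rightarrow> 0)"

text \<open>A zero test of register \<open>i\<close> moves \<open>Xb i\<close> to \<open>X i\<close> and back. It gains \<open>2 * K\<close> units of \<open>Y\<close>
  only if the register is zero and both transfers are complete, and fewer units otherwise.\<close>

fun gadget :: "'q \<Rightarrow> act \<Rightarrow> 'q \<Rightarrow> 'q trans set" where
  "gadget q Nop q' = {(At q, zero_vec, At q')}"
| "gadget q (Incr i) q' = {(At q, zero_vec(X i := 1, Xb i := -1), At q')}"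
| "gadget q (Decr i) q' = {(At q, zero_vec(X i := -1, Xb i := 1), At q')}"
| "gadget q (IsZ i) q' =
    {(At q, zero_vec(T := -1), Z1 i q'),
     (Z1 i q', zero_vec(X i := 1, Xb i := -1, Y := 1), Z1 i q'),
     (Z1 i q', zero_vec, Z2 i q'),
     (Z2 i q', zero_vec(X i := -1, Xb i := 1, Y := 1), Z2 i q'),
     (Z2 i q', zero_vec, At q')}"

fun act_regs :: "act \<Rightarrow> nat set" where
  "act_regs Nop = {}"
| "act_regs (Incr i) = {i}"
| "act_regs (Decr i) = {i}"
| "act_regs (IsZ i) = {i}"

definition vass :: "('q \<times> act \<times> 'q) set \<Rightarrow> nat \<Rightarrow> 'q \<Rightarrow> 'q \<Rightarrow> 'q trans set" where
  "vass D m start park = {(Guess, guess_vec m, Guess), (Guess, zero_vec, At start),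
     (Guess, zero_vec, At park), (At park, zero_vec, Fin), (Fin, flush_vec m, Fin)} \<union>
     (\<Union>(q, a, q')\<in>D. gadget q a q')"

definition bonus :: "'q \<Rightarrow> 'q trans" where
  "bonus halt = (At halt, zero_vec(Y := 1), Fin)"

definition vstep :: "('q loc \<times> ('c \<Rightarrow> int) \<times> 'q loc) set \<Rightarrow>
    'q loc \<times> ('c \<Rightarrow> nat) \<Rightarrow> 'q loc \<times> ('c \<Rightarrow> nat) \<Rightarrow> bool" where
  "vstep S x y \<longleftrightarrow> (\<exists>d. (fst x, d, fst y) \<in> S \<and> effect d (snd x) (snd y))"

lemma vstepI: "(l, d, l') \<in> S \<Longrightarrow> effect d v w \<Longrightarrow> vstep S (l, v) (l', w)"
  by (auto simp: vstep_def)

lemma vsteps_mono: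
  assumes "(vstep S)\<^sup>*\<^sup>* x y" "S \<subseteq> S'"
  shows "(vstep S')\<^sup>*\<^sup>* x y"
proof -
  have "vstep S \<le> vstep S'" using assms(2) by (fastforce simp: vstep_def)
  with assms(1) show ?thesis using rtranclp_mono by blast
qed

text \<open>The subtraction is truncated, so for \<open>i < m\<close> the balance
  \<open>X i + Xb i = K\<close> holds only if \<open>s i <= k\<close>. This is one source of the
  lower bounds on \<open>k\<close> below.\<close>

definition conf :: "nat \<Rightarrow> (nat \<Rightarrow> nat) \<Rightarrow> nat \<Rightarrow> nat \<Rightarrow> nat \<Rightarrow> coord \<Rightarrow> nat" where
  "conf m s k t y c = (case c of K \<Rightarrow> k | Y \<Rightarrow> y | T \<Rightarrow> t | X i \<Rightarrow> s i
     | Xb i \<Rightarrow> if i < m then k - s i else 0)"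

lemma conf_simps [simp]:
  "conf m s k t y K = k" "conf m s k t y Y = y" "conf m s k t y T = t"
  "conf m s k t y (X i) = s i" "conf m s k t y (Xb i) = (if i < m then k - s i else 0)"
  by (simp_all add: conf_def)

lemma coord_fun_eqI:
  assumes "v K = w K" "v Y = w Y" "v T = w T" "\<And>i. v (X i) = w (X i)" "\<And>i. v (Xb i) = w (Xb i)"
  shows "v = w"
proof
  show "v c = w c" for c using assms by (cases c) auto
qed

text \<open>\<open>park\<close> and \<open>halt\<close> loop on a test of \<open>z\<close>: a
  simulation with tests left can spend them there, gaining \<open>2 * K\<close> units of
  \<open>Y\<close> for each while \<open>z\<close> is zero.\<close>

locale budget_machine =
  fixes D :: "('q \<times> act \<times> 'q) set" and m :: nat and start park halt :: 'q
    and s0 :: "nat \<Rightarrow> nat" and k0 z :: nat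
  assumes regs: "(q, a, q') \<in> D \<Longrightarrow> i \<in> act_regs a \<Longrightarrow> i < m"
    and s0_le: "s0 i \<le> k0"
    and park: "(park, IsZ z, park) \<in> D" "(park, a, q) \<in> D \<Longrightarrow> a = IsZ z \<and> q = park"
    and park_ne_halt: "park \<noteq> halt"
    and s0_z: "s0 z = 0"
    and halt: "(halt, IsZ z, halt) \<in> D"
begin

section \<open>Upper bounds on \<open>Y\<close>: an invariant for both systems\<close>

definition honest :: "'q \<Rightarrow> (nat \<Rightarrow> nat) \<Rightarrow> bool" where
  "honest q s \<longleftrightarrow> (mstep D)\<^sup>*\<^sup>* (start, s0) (q, s) \<or> (mstep D)\<^sup>*\<^sup>* (park, s0) (q, s)"

definition halts :: bool where
  "halts \<longleftrightarrow> (\<exists>s. (mstep D)\<^sup>*\<^sup>* (start, s0) (halt, s))"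

abbreviation V :: "'q trans set" where
  "V \<equiv> vass D m start park"

abbreviation init :: "'q loc \<times> (coord \<Rightarrow> nat)" where
  "init \<equiv> (Guess, conf m s0 k0 k0 0)"

definition regs_of :: "(coord \<Rightarrow> nat) \<Rightarrow> nat \<Rightarrow> nat" where
  "regs_of v = (\<lambda>i. v (X i))"

definition balanced :: "(coord \<Rightarrow> nat) \<Rightarrow> bool" where
  "balanced v \<longleftrightarrow> (\<forall>i<m. v (X i) + v (Xb i) = v K)"

text \<open>The value \<open>Y + 2 * K * T\<close>, adapted inside a zero test to the gain that is still possible,
  never exceeds \<open>2 * K * K\<close>, and it stays there only along faithful simulations.\<close>

fun inv :: "'q loc \<times> (coord \<Rightarrow> nat) \<Rightarrow> bool" where
  "inv (Guess, v) \<longleftrightarrow> k0 \<le> v K \<and> v = conf m s0 (v K) (v K) 0"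
| "inv (At q, v) \<longleftrightarrow> k0 \<le> v K \<and> balanced v \<and> v Y + 2 * v K * v T \<le> 2 * v K * v K \<and>
     (v Y + 2 * v K * v T = 2 * v K * v K \<longrightarrow> honest q (regs_of v))"
| "inv (Z1 i q, v) \<longleftrightarrow> i < m \<and> k0 \<le> v K \<and> balanced v \<and>
     v Y + v (Xb i) + v K + 2 * v K * v T \<le> 2 * v K * v K \<and>
     (v Y + v (Xb i) + v K + 2 * v K * v T = 2 * v K * v K \<longrightarrow> honest q ((regs_of v)(i := 0)))"
| "inv (Z2 i q, v) \<longleftrightarrow> i < m \<and> k0 \<le> v K \<and> balanced v \<and>
     v Y + v (X i) + 2 * v K * v T \<le> 2 * v K * v K \<and>
     (v Y + v (X i) + 2 * v K * v T = 2 * v K * v K \<longrightarrow> honest q ((regs_of v)(i := 0)))"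
| "inv (Fin, v) \<longleftrightarrow> k0 \<le> v K \<and> v Y \<le> 2 * v K * v K"

lemma inv_Y_le: "inv (l, v) \<Longrightarrow> v Y \<le> 2 * v K * v K"
proof (cases l)
  case Guess
  assume "inv (l, v)"
  with Guess have "v = conf m s0 (v K) (v K) 0" by simp
  then have "v Y = 0" by (metis conf_simps(2))
  then show ?thesis by simp
qed auto

lemma inv_K_ge: "inv (l, v) \<Longrightarrow> k0 \<le> v K"
  by (cases l) auto

lemma honest_step: "honest q s \<Longrightarrow> (q, a, q') \<in> D \<Longrightarrow> act_rel a s t \<Longrightarrow> honest q' t"
  unfolding honest_def
  by (metis fst_conv snd_conv mstep_def rtranclp.rtrancl_into_rtrancl)

lemma honest_park: "(mstep D)\<^sup>*\<^sup>* (park, s0) (q, s) \<Longrightarrow> q = park"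
proof (induction q s rule: rtranclp_induct2)
  case (step q s q' s')
  from step.hyps(2) obtain a where "(q, a, q') \<in> D" by (auto simp: mstep_def)
  with step.IH park(2) show ?case by blast
qed simp

lemma honest_halt_iff: "(\<exists>s. honest halt s) \<longleftrightarrow> halts"
  unfolding honest_def halts_def using honest_park park_ne_halt by auto

lemma balanced_upd [simp]:
  "balanced (v(T := t)) \<longleftrightarrow> balanced v"
  "balanced (v(Y := y)) \<longleftrightarrow> balanced v"
  by (simp_all add: balanced_def)

lemma regs_of_upd [simp]:
  "regs_of (v(T := t)) = regs_of v"
  "regs_of (v(Y := t)) = regs_of v"
  "regs_of (v(Xb i := t)) = regs_of v"
  "regs_of (v(X i := t)) = (regs_of v)(i := t)"
  by (auto simp: regs_of_def)

lemma balanced_up: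
  "balanced v \<Longrightarrow> 0 < v (Xb i) \<Longrightarrow> balanced (v(X i := Suc (v (X i)), Xb i := v (Xb i) - 1))"
  by (auto simp: balanced_def)

lemma balanced_down:
  "balanced v \<Longrightarrow> 0 < v (X i) \<Longrightarrow> balanced (v(X i := v (X i) - 1, Xb i := Suc (v (Xb i))))"
  by (auto simp: balanced_def)

text \<open>By \<open>X i + Xb i = K\<close> all losses can be read off. Entering a test trades
  \<open>2 * K\<close> for \<open>Xb i + K\<close> and loses \<open>X i\<close>; each transfer
  trades one unit for one unit of \<open>Y\<close>; switching loses \<open>2 * Xb i\<close>, and
  leaving loses \<open>X i\<close>. Attaining the bound thus rules out every loss.\<close>

lemma inv_gadget:
  assumes D: "(q, a, q') \<in> D" and g: "(l, d, l') \<in> gadget q a q'"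
    and I: "inv (l, v)" and e: "effect d v w"
  shows "inv (l', w)"
proof (cases a)
  case Nop
  with g e I honest_step[OF _ D] show ?thesis by auto
next
  case (Incr i)
  with g e have l: "l = At q" "l' = At q'" and v: "0 < v (Xb i)"
    and w: "w = v(X i := Suc (v (X i)), Xb i := v (Xb i) - 1)" by (auto simp: fun_upd_twist)
  have "honest q (regs_of v) \<Longrightarrow> honest q' ((regs_of v)(i := Suc (v (X i))))"
    using honest_step[OF _ D] Incr by (auto simp: regs_of_def)
  with I balanced_up[of v i, OF _ v] show ?thesis by (auto simp: l w)
next
  case (Decr i)
  with g e have l: "l = At q" "l' = At q'" and v: "0 < v (X i)"
    and w: "w = v(X i := v (X i) - 1, Xb i := Suc (v (Xb i)))" by (auto simp: fun_upd_twist)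
  have "honest q (regs_of v) \<Longrightarrow> honest q' ((regs_of v)(i := v (X i) - 1))"
    using honest_step[OF _ D] Decr v by (auto simp: regs_of_def)
  with I balanced_down[of v i, OF _ v] show ?thesis by (auto simp: l w)
next
  case (IsZ i)
  have i: "i < m" using regs[OF D] IsZ by simp
  have bal: "v (X i) + v (Xb i) = v K" if "balanced v" using that i by (simp add: balanced_def)
  from g IsZ consider
      (enter) "l = At q" "l' = Z1 i q'" "d = zero_vec(T := -1)"
    | (up) "l = Z1 i q'" "l' = Z1 i q'" "d = zero_vec(X i := 1, Xb i := -1, Y := 1)"
    | (switch) "l = Z1 i q'" "l' = Z2 i q'" "d = zero_vec"
    | (down) "l = Z2 i q'" "l' = Z2 i q'" "d = zero_vec(X i := -1, Xb i := 1, Y := 1)"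
    | (leave) "l = Z2 i q'" "l' = At q'" "d = zero_vec"
    by auto
  then show ?thesis
  proof cases
    case enter
    with e have t: "0 < v T" and w: "w = v(T := v T - 1)" by auto
    then obtain t where t: "v T = Suc t" using gr0_implies_Suc by auto
    have I': "balanced v" "v Y + 2 * v K * v T \<le> 2 * v K * v K" "k0 \<le> v K"
      "v Y + 2 * v K * v T = 2 * v K * v K \<Longrightarrow> honest q (regs_of v)"
      using I enter by auto
    have "honest q' ((regs_of v)(i := 0))"
      if "v Y + v (Xb i) + v K + 2 * v K * t = 2 * v K * v K"
    proof -
      have "v (X i) = 0" using that bal[OF I'(1)] I'(2) t by (auto simp: algebra_simps)
      then have eq: "(regs_of v)(i := 0) = regs_of v" by (auto simp: regs_of_def)
      have "v Y + 2 * v K * v T = 2 * v K * v K"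
        using that bal[OF I'(1)] I'(2) t by (auto simp: algebra_simps)
      from honest_step[OF I'(4)[OF this] D, of "regs_of v"] IsZ \<open>v (X i) = 0\<close> show ?thesis
        unfolding eq by (simp add: regs_of_def)
    qed
    moreover have "v Y + v (Xb i) + v K + 2 * v K * t \<le> 2 * v K * v K"
      using bal[OF I'(1)] I'(2) t by (auto simp: algebra_simps)
    ultimately show ?thesis using enter i I' t by (simp add: w)
  next
    case up
    with e have v: "0 < v (Xb i)"
      and w: "w = v(X i := Suc (v (X i)), Xb i := v (Xb i) - 1, Y := Suc (v Y))"
      by (auto simp: fun_upd_twist)
    from I up balanced_up[of v i, OF _ v] v show ?thesis by (auto simp: w)
  next
    case switch
    with e have w: "w = v" by simp
    have I': "balanced v" "v Y + v (Xb i) + v K + 2 * v K * v T \<le> 2 * v K * v K" "k0 \<le> v K"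
      "v Y + v (Xb i) + v K + 2 * v K * v T = 2 * v K * v K \<Longrightarrow>
        honest q' ((regs_of v)(i := 0))"
      using I switch by auto
    have "v Y + v (Xb i) + v K + 2 * v K * v T = 2 * v K * v K"
      if "v Y + v (X i) + 2 * v K * v T = 2 * v K * v K"
      using that bal[OF I'(1)] I'(2) by linarith
    moreover have "v Y + v (X i) + 2 * v K * v T \<le> 2 * v K * v K"
      using bal[OF I'(1)] I'(2) by linarith
    ultimately show ?thesis using switch i I' by (simp add: w)
  next
    case down
    with e have v: "0 < v (X i)"
      and w: "w = v(X i := v (X i) - 1, Xb i := Suc (v (Xb i)), Y := Suc (v Y))"
      by (auto simp: fun_upd_twist)
    from I down balanced_down[of v i, OF _ v] v show ?thesis by (auto simp: w)
  next
    case leave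
    with e have w: "w = v" by simp
    have I': "balanced v" "v Y + v (X i) + 2 * v K * v T \<le> 2 * v K * v K" "k0 \<le> v K"
      "v Y + v (X i) + 2 * v K * v T = 2 * v K * v K \<Longrightarrow> honest q' ((regs_of v)(i := 0))"
      using I leave by auto
    have "honest q' (regs_of v)" if "v Y + 2 * v K * v T = 2 * v K * v K"
    proof -
      \<comment> \<open>The return transfer was complete, so resetting register \<open>i\<close> in
        the store changes nothing.\<close>
      have "v (X i) = 0" using that I'(2) by linarith
      then have "(regs_of v)(i := 0) = regs_of v" by (auto simp: regs_of_def)
      with I'(4) that \<open>v (X i) = 0\<close> show ?thesis by simp
    qed
    then show ?thesis using leave i I' by (simp add: w)
  qed
qed

lemma effect_guess_vec:
  assumes "k0 \<le> k"
  shows "effect (guess_vec m) (conf m s0 k k 0) w \<longleftrightarrow> w = conf m s0 (Suc k) (Suc k) 0"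
proof -
  have "s0 i \<le> k" for i using s0_le assms by (rule order_trans)
  then have "int (conf m s0 (Suc k) (Suc k) 0 c) = int (conf m s0 k k 0 c) + guess_vec m c" for c
    by (cases c) (auto simp: guess_vec_def Suc_diff_le)
  then show ?thesis unfolding effect_def fun_eq_iff by (metis of_nat_eq_iff)
qed

text \<open>With \<open>Y = 0\<close> and \<open>T = K\<close> the bound is attained, so the honesty
  clause is in force from the first state on.\<close>

lemma inv_At_init:
  assumes "k0 \<le> k" "honest q s0"
  shows "inv (At q, conf m s0 k k 0)"
proof -
  have "s0 i \<le> k" for i using s0_le assms(1) by (rule order_trans)
  with assms show ?thesis by (simp add: balanced_def regs_of_def)
qed

lemma inv_step:
  assumes S: "S \<subseteq> insert (bonus halt) V" "bonus halt \<in> S \<Longrightarrow> \<not> halts"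
    and step: "vstep S (l, v) (l', w)" and I: "inv (l, v)"
  shows "inv (l', w)"
proof -
  from step obtain d where d: "(l, d, l') \<in> S" and e: "effect d v w"
    by (auto simp: vstep_def)
  from d S consider
      (guess) "l = Guess" "l' = Guess" "d = guess_vec m"
    | (start) "l = Guess" "l' = At start" "d = zero_vec"
    | (park) "l = Guess" "l' = At park" "d = zero_vec"
    | (finish) "l = At park" "l' = Fin" "d = zero_vec"
    | (flush) "l = Fin" "l' = Fin" "d = flush_vec m"
    | (bonus) "l = At halt" "l' = Fin" "d = zero_vec(Y := 1)" "\<not> halts"
    | (gadget) q a q' where "(q, a, q') \<in> D" "(l, d, l') \<in> gadget q a q'"
  proof -
    from d S consider "(l, d, l') = bonus halt" "\<not> halts" | "(l, d, l') \<in> V" by auto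
    then show ?thesis
    proof cases
      case 1
      then show ?thesis using that(6) by (simp add: bonus_def)
    next
      case 2
      then show ?thesis
        unfolding vass_def Un_iff UN_iff
        by (elim disjE bexE) (use that in \<open>auto split: prod.splits\<close>)
    qed
  qed
  then show ?thesis
  proof cases
    case guess
    with I have v: "k0 \<le> v K" "v = conf m s0 (v K) (v K) 0" by simp_all
    with e guess have "w = conf m s0 (Suc (v K)) (Suc (v K)) 0"
      using effect_guess_vec by metis
    with v(1) guess show ?thesis by simp
  next
    case start
    with I have v: "k0 \<le> v K" "v = conf m s0 (v K) (v K) 0" by simp_all
    have "inv (At start, conf m s0 (v K) (v K) 0)"
      using v(1) by (rule inv_At_init) (simp add: honest_def)
    with e start v(2) show ?thesis by simp
  next
    case park
    with I have v: "k0 \<le> v K" "v = conf m s0 (v K) (v K) 0" by simp_all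
    have "inv (At park, conf m s0 (v K) (v K) 0)"
      using v(1) by (rule inv_At_init) (simp add: honest_def)
    with e park v(2) show ?thesis by simp
  next
    case finish
    with I e show ?thesis by simp
  next
    case flush
    have "int (w K) = int (v K) + 0" "int (w Y) = int (v Y) + 0"
      using e flush by (auto simp: effect_def flush_vec_def)
    with I flush show ?thesis by simp
  next
    case bonus
    \<comment> \<open>Without an honest configuration at \<open>halt\<close> the bound is not
      attained there, and one more unit of \<open>Y\<close> still fits below it.\<close>
    then have "\<not> honest halt s" for s using honest_halt_iff by blast
    with I bonus have "v Y + 2 * v K * v T < 2 * v K * v K" "k0 \<le> v K" by auto
    moreover have "w = v(Y := Suc (v Y))" using e bonus by simp
    ultimately show ?thesis using bonus by simp
  next
    case gadget
    then show ?thesis using inv_gadget I e by blast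
  qed
qed

lemma inv_reachable:
  assumes "S \<subseteq> insert (bonus halt) V" "bonus halt \<in> S \<Longrightarrow> \<not> halts" "(vstep S)\<^sup>*\<^sup>* init x"
  shows "inv x"
  using assms(3)
proof (induction rule: rtranclp_induct)
  case (step x y)
  then show ?case using inv_step[OF assms(1,2)] by (metis surj_pair)
qed simp

section \<open>Lower bounds on \<open>Y\<close>: faithful runs that spend the whole budget\<close>

lemma reach_guess:
  assumes "k0 \<le> k"
  shows "(vstep V)\<^sup>*\<^sup>* init (Guess, conf m s0 k k 0)"
  using assms
proof (induction k rule: dec_induct)
  case (step k)
  have "vstep V (Guess, conf m s0 k k 0) (Guess, conf m s0 (Suc k) (Suc k) 0)"
    using step.hyps effect_guess_vec by (intro vstepI[where d = "guess_vec m"]) (auto simp: vass_def)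
  with step.IH show ?case by (rule rtranclp.rtrancl_into_rtrancl)
qed simp

lemma gadget_subset: "(q, a, q') \<in> D \<Longrightarrow> gadget q a q' \<subseteq> V"
  by (auto simp: vass_def)

lemma reach_Z1:
  assumes D: "(q, IsZ i, q') \<in> D"
  shows "n \<le> v (Xb i) \<Longrightarrow> (vstep V)\<^sup>*\<^sup>* (Z1 i q', v)
    (Z1 i q', v(X i := v (X i) + n, Xb i := v (Xb i) - n, Y := v Y + n))"
proof (induction n)
  case (Suc n)
  let ?w = "\<lambda>n. v(X i := v (X i) + n, Xb i := v (Xb i) - n, Y := v Y + n)"
  have "vstep V (Z1 i q', ?w n) (Z1 i q', ?w (Suc n))"
    using gadget_subset[OF D] Suc.prems
    by (intro vstepI[where d = "zero_vec(X i := 1, Xb i := -1, Y := 1)"])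
      (auto simp: fun_eq_iff)
  with Suc.IH[OF Suc_leD[OF Suc.prems]] show ?case by (rule rtranclp.rtrancl_into_rtrancl)
qed (simp add: fun_upd_idem)

lemma reach_Z2:
  assumes D: "(q, IsZ i, q') \<in> D"
  shows "n \<le> v (X i) \<Longrightarrow> (vstep V)\<^sup>*\<^sup>* (Z2 i q', v)
    (Z2 i q', v(X i := v (X i) - n, Xb i := v (Xb i) + n, Y := v Y + n))"
proof (induction n)
  case (Suc n)
  let ?w = "\<lambda>n. v(X i := v (X i) - n, Xb i := v (Xb i) + n, Y := v Y + n)"
  have "vstep V (Z2 i q', ?w n) (Z2 i q', ?w (Suc n))"
    using gadget_subset[OF D] Suc.prems
    by (intro vstepI[where d = "zero_vec(X i := -1, Xb i := 1, Y := 1)"])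
      (auto simp: fun_eq_iff)
  with Suc.IH[OF Suc_leD[OF Suc.prems]] show ?case by (rule rtranclp.rtrancl_into_rtrancl)
qed (simp add: fun_upd_idem)

lemma reach_zero_test:
  assumes D: "(q, IsZ i, q') \<in> D" and s: "s i = 0"
  shows "(vstep V)\<^sup>*\<^sup>* (At q, conf m s k (Suc t) y) (At q', conf m s k t (y + 2 * k))"
proof -
  have i: "i < m" using regs[OF D] by simp
  have G: "(At q, zero_vec(T := -1), Z1 i q') \<in> V" "(Z1 i q', zero_vec, Z2 i q') \<in> V"
    "(Z2 i q', zero_vec, At q') \<in> V"
    using gadget_subset[OF D] by simp_all
  let ?v = "conf m s k t y"
  let ?w = "?v(X i := k, Xb i := 0, Y := y + k)"
  let ?u = "conf m s k t (y + 2 * k)"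
  have "effect (zero_vec(T := -1)) (conf m s k (Suc t) y) ?v"
    by (simp, rule coord_fun_eqI) simp_all
  with G(1) have 1: "vstep V (At q, conf m s k (Suc t) y) (Z1 i q', ?v)" by (rule vstepI)
  have 2: "(vstep V)\<^sup>*\<^sup>* (Z1 i q', ?v) (Z1 i q', ?w)"
    using reach_Z1[OF D, of k ?v] i s by simp
  have 3: "vstep V (Z1 i q', ?w) (Z2 i q', ?w)"
    using G(2) by (rule vstepI) simp
  have "?w(X i := ?w (X i) - k, Xb i := ?w (Xb i) + k, Y := ?w Y + k) = ?u"
    using i s by (intro coord_fun_eqI) simp_all
  with reach_Z2[OF D, of k ?w] have 4: "(vstep V)\<^sup>*\<^sup>* (Z2 i q', ?w) (Z2 i q', ?u)" by simp
  have 5: "vstep V (Z2 i q', ?u) (At q', ?u)"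
    using G(3) by (rule vstepI) simp
  show ?thesis
    using converse_rtranclp_into_rtranclp[OF 1 2] converse_rtranclp_into_rtranclp[OF 3 4] 5
    by (meson rtranclp_trans rtranclp.rtrancl_into_rtrancl)
qed

lemma reach_zero_tests:
  assumes "(q, IsZ i, q) \<in> D" "s i = 0"
  shows "(vstep V)\<^sup>*\<^sup>* (At q, conf m s k (t + n) y) (At q, conf m s k t (y + 2 * k * n))"
proof (induction n arbitrary: y)
  case (Suc n)
  have "(vstep V)\<^sup>*\<^sup>* (At q, conf m s k (t + Suc n) y) (At q, conf m s k (t + n) (y + 2 * k))"
    using reach_zero_test[of q i q s, OF assms, of k "t + n" y] by simp
  from rtranclp_trans[OF this Suc.IH]
  have "(vstep V)\<^sup>*\<^sup>* (At q, conf m s k (t + Suc n) y)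
      (At q, conf m s k t (y + 2 * k + 2 * k * n))" .
  moreover have eq: "y + 2 * k + 2 * k * n = y + 2 * k * Suc n" by simp
  ultimately show ?case unfolding eq by blast
qed simp

text \<open>\<open>t\<close> is the number of tests used, and \<open>N\<close> keeps the registers
  within range. The rest \<open>t'\<close> of the budget and the value \<open>y\<close> stay open so
  that steps can be chained.\<close>

lemma reach_step:
  assumes "mstep D (q, s) (q', s')"
  shows "\<exists>t N. \<forall>k\<ge>N. \<forall>t' y. (vstep V)\<^sup>*\<^sup>* (At q, conf m s k (t' + t) y)
    (At q', conf m s' k t' (y + 2 * k * t))"
proof -
  from assms obtain a where D: "(q, a, q') \<in> D" and a: "act_rel a s s'"
    by (auto simp: mstep_def)
  note G = gadget_subset[OF D]
  show ?thesis
  proof (cases a)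
    case Nop
    have "(vstep V)\<^sup>*\<^sup>* (At q, conf m s k t y) (At q', conf m s' k t y)" for k t y
      using G a Nop by (intro r_into_rtranclp vstepI[where d = zero_vec]) auto
    then show ?thesis by (intro exI[of _ 0]) simp
  next
    case (Incr i)
    have "(vstep V)\<^sup>*\<^sup>* (At q, conf m s k t y) (At q', conf m s' k t y)" if "Suc (s i) \<le> k" for k t y
      using G a Incr that regs[OF D]
      by (intro r_into_rtranclp vstepI[where d = "zero_vec(X i := 1, Xb i := -1)"])
        (auto intro!: coord_fun_eqI)
    then show ?thesis by (intro exI[of _ 0] exI[of _ "Suc (s i)"]) simp
  next
    case (Decr i)
    \<comment> \<open>Here \<open>s i <= k\<close> makes \<open>k - s i\<close> a true difference,
      so that \<open>Xb i\<close> really grows by one.\<close>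
    have "(vstep V)\<^sup>*\<^sup>* (At q, conf m s k t y) (At q', conf m s' k t y)" if "s i \<le> k" for k t y
      using G a Decr that regs[OF D]
      by (intro r_into_rtranclp vstepI[where d = "zero_vec(X i := -1, Xb i := 1)"])
        (auto intro!: coord_fun_eqI)
    then show ?thesis by (intro exI[of _ 0] exI[of _ "s i"]) simp
  next
    case (IsZ i)
    with a D have "(vstep V)\<^sup>*\<^sup>* (At q, conf m s k (t + 1) y) (At q', conf m s' k t (y + 2 * k * 1))"
      for k t y
      using reach_zero_test[of q i q' s] by simp
    then show ?thesis by blast
  qed
qed

lemma reach_run:
  assumes "(mstep D)\<^sup>*\<^sup>* (q, s) (q', s')"
  shows "\<exists>t N. \<forall>k\<ge>N. \<forall>t' y. (vstep V)\<^sup>*\<^sup>* (At q, conf m s k (t' + t) y)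
    (At q', conf m s' k t' (y + 2 * k * t))"
  using assms
proof (induction q s rule: converse_rtranclp_induct2)
  case refl
  show ?case by (intro exI[of _ 0]) simp
next
  case (step q s r u)
  from reach_step[OF step.hyps(1)] obtain t N where
    1: "\<forall>k\<ge>N. \<forall>t' y. (vstep V)\<^sup>*\<^sup>* (At q, conf m s k (t' + t) y) (At r, conf m u k t' (y + 2 * k * t))"
    by blast
  from step.IH obtain t2 N2 where
    2: "\<forall>k\<ge>N2. \<forall>t' y. (vstep V)\<^sup>*\<^sup>* (At r, conf m u k (t' + t2) y)
      (At q', conf m s' k t' (y + 2 * k * t2))"
    by blast
  show ?case
  proof (rule exI[of _ "t2 + t"], rule exI[of _ "max N N2"], intro allI impI)
    fix k t' y assume k: "max N N2 \<le> k"
    have "(vstep V)\<^sup>*\<^sup>* (At q, conf m s k (t' + t2 + t) y) (At r, conf m u k (t' + t2) (y + 2 * k * t))"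
      using 1 k by simp
    moreover have "(vstep V)\<^sup>*\<^sup>* (At r, conf m u k (t' + t2) (y + 2 * k * t))
        (At q', conf m s' k t' (y + 2 * k * t + 2 * k * t2))"
      using 2 k by simp
    ultimately have "(vstep V)\<^sup>*\<^sup>* (At q, conf m s k (t' + t2 + t) y)
        (At q', conf m s' k t' (y + 2 * k * t + 2 * k * t2))"
      by (rule rtranclp_trans)
    moreover have eqs: "t' + t2 + t = t' + (t2 + t)"
      "y + 2 * k * t + 2 * k * t2 = y + 2 * k * (t2 + t)"
      by (simp_all add: add_mult_distrib2)
    ultimately show "(vstep V)\<^sup>*\<^sup>* (At q, conf m s k (t' + (t2 + t)) y)
        (At q', conf m s' k t' (y + 2 * k * (t2 + t)))"
      unfolding eqs by blast
  qed
qed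

lemma reach_bonus:
  assumes "(mstep D)\<^sup>*\<^sup>* (start, s0) (halt, s)" "s z = 0"
  shows "\<exists>w. (vstep (insert (bonus halt) V))\<^sup>*\<^sup>* init (Fin, w) \<and> w Y = Suc (2 * w K * w K)"
proof -
  let ?V = "insert (bonus halt) V"
  from reach_run[OF assms(1)] obtain t N where
    run: "\<forall>k\<ge>N. \<forall>t' y. (vstep V)\<^sup>*\<^sup>* (At start, conf m s0 k (t' + t) y)
      (At halt, conf m s k t' (y + 2 * k * t))"
    by blast
  \<comment> \<open>\<open>k = n + t\<close> is at least \<open>N\<close> and \<open>k0\<close>. Of
    the \<open>k\<close> tests the run uses \<open>t\<close> and the loop at \<open>halt\<close>
    spends the other \<open>n\<close>, so \<open>Y\<close> reaches \<open>2 * k * k\<close>.\<close>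
  define n where "n = N + k0"
  define k where "k = n + t"
  let ?y = "2 * k * t + 2 * k * n"
  have 1: "(vstep V)\<^sup>*\<^sup>* init (Guess, conf m s0 k k 0)"
    by (rule reach_guess) (simp add: k_def n_def)
  have 2: "vstep V (Guess, conf m s0 k k 0) (At start, conf m s0 k k 0)"
    by (rule vstepI[where d = zero_vec]) (auto simp: vass_def)
  have 3: "(vstep V)\<^sup>*\<^sup>* (At start, conf m s0 k k 0) (At halt, conf m s k n (2 * k * t))"
    using run[rule_format, of k n 0] by (simp add: k_def n_def)
  have 4: "(vstep V)\<^sup>*\<^sup>* (At halt, conf m s k n (2 * k * t)) (At halt, conf m s k 0 ?y)"
    using reach_zero_tests[of halt z s k 0 n "2 * k * t", OF halt assms(2)] unfolding add_0 .
  have "(vstep V)\<^sup>*\<^sup>* init (At halt, conf m s k 0 ?y)"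
    using rtranclp.rtrancl_into_rtrancl[OF 1 2] 3 4 by (meson rtranclp_trans)
  then have 5: "(vstep ?V)\<^sup>*\<^sup>* init (At halt, conf m s k 0 ?y)"
    by (rule vsteps_mono) auto
  have 6: "vstep ?V (At halt, conf m s k 0 ?y) (Fin, conf m s k 0 (Suc ?y))"
  proof (rule vstepI)
    show "(At halt, zero_vec(Y := 1), Fin) \<in> ?V" by (simp add: bonus_def)
    show "effect (zero_vec(Y := 1)) (conf m s k 0 ?y) (conf m s k 0 (Suc ?y))"
      by (simp, rule coord_fun_eqI) simp_all
  qed
  have y: "?y = 2 * k * k"
    unfolding k_def by (simp add: algebra_simps)
  have "(vstep ?V)\<^sup>*\<^sup>* init (Fin, conf m s k 0 (Suc ?y))"
    using 5 6 by (rule rtranclp.rtrancl_into_rtrancl)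
  moreover have "conf m s k 0 (Suc ?y) Y = Suc (2 * conf m s k 0 (Suc ?y) K * conf m s k 0 (Suc ?y) K)"
    unfolding conf_simps y ..
  ultimately show ?thesis by (intro exI conjI)
qed

lemma effect_flush_vec:
  "effect (flush_vec m) (\<lambda>c. v c + n * nat (flush_vec m c)) (\<lambda>c. v c + Suc n * nat (flush_vec m c))"
proof -
  have "0 \<le> flush_vec m c" for c by (simp add: flush_vec_def split: coord.splits)
  then show ?thesis by (simp add: effect_def algebra_simps)
qed

lemma vstep_flush:
  "vstep V (Fin, \<lambda>c. v c + n * nat (flush_vec m c)) (Fin, \<lambda>c. v c + Suc n * nat (flush_vec m c))"
  by (rule vstepI[of _ "flush_vec m", OF _ effect_flush_vec[of v n]]) (simp add: vass_def)

lemma reach_flush: "(vstep V)\<^sup>*\<^sup>* (Fin, v) (Fin, \<lambda>c. v c + n * nat (flush_vec m c))"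
proof (induction n)
  case (Suc n)
  from Suc.IH vstep_flush[of v n] show ?case by (rule rtranclp.rtrancl_into_rtrancl)
qed simp

definition covers :: "nat \<Rightarrow> nat \<Rightarrow> (coord \<Rightarrow> nat) \<Rightarrow> bool" where
  "covers k n w \<longleftrightarrow> w K = k \<and> w Y = 2 * k * k \<and> n \<le> w T \<and>
     (\<forall>i<m. n \<le> w (X i) \<and> n \<le> w (Xb i))"

text \<open>The \<open>park\<close> branch spends all \<open>k\<close> tests on \<open>z\<close> and
  then flushes. Two consecutive vectors are provided because they will carry opposite parity
  bits.\<close>

lemma reach_covers:
  assumes "k0 \<le> k"
  shows "\<exists>w w'. (vstep V)\<^sup>*\<^sup>* init (Fin, w) \<and> vstep V (Fin, w) (Fin, w') \<and>
    covers k n w \<and> covers k n w'"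
proof -
  let ?v = "conf m s0 k 0 (2 * k * k)"
  let ?w = "\<lambda>n c. ?v c + n * nat (flush_vec m c)"
  have 1: "(vstep V)\<^sup>*\<^sup>* init (Guess, conf m s0 k k 0)"
    using assms by (rule reach_guess)
  have 2: "vstep V (Guess, conf m s0 k k 0) (At park, conf m s0 k k 0)"
    by (rule vstepI[where d = zero_vec]) (auto simp: vass_def)
  have 3: "(vstep V)\<^sup>*\<^sup>* (At park, conf m s0 k k 0) (At park, ?v)"
    using reach_zero_tests[of park z s0 k 0 k 0, OF park(1) s0_z] unfolding add_0 .
  have 4: "vstep V (At park, ?v) (Fin, ?v)"
    by (rule vstepI[where d = zero_vec]) (auto simp: vass_def)
  from 1 2 have "(vstep V)\<^sup>*\<^sup>* init (At park, conf m s0 k k 0)"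
    by (rule rtranclp.rtrancl_into_rtrancl)
  from this 3 have "(vstep V)\<^sup>*\<^sup>* init (At park, ?v)"
    by (rule rtranclp_trans)
  from this 4 have "(vstep V)\<^sup>*\<^sup>* init (Fin, ?v)"
    by (rule rtranclp.rtrancl_into_rtrancl)
  from this reach_flush[of ?v n] have "(vstep V)\<^sup>*\<^sup>* init (Fin, ?w n)"
    by (rule rtranclp_trans)
  moreover have "vstep V (Fin, ?w n) (Fin, ?w (Suc n))"
    by (rule vstep_flush[of ?v n])
  moreover have "covers k n (?w n)" "covers k n (?w (Suc n))"
    by (auto simp: covers_def flush_vec_def)
  ultimately show ?thesis by blast
qed

lemma vstep_Fin: "vstep V (Fin, v) (l, w) \<Longrightarrow> l = Fin"
proof -
  assume "vstep V (Fin, v) (l, w)"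
  then obtain d where d: "(Fin, d, l) \<in> V" by (auto simp: vstep_def)
  have "(Fin, d, l) \<notin> gadget q a q'" for d l and q q' :: 'q and a by (cases a) auto
  with d show ?thesis by (auto simp: vass_def)
qed

text \<open>Only finitely many coordinates are ever changed, so a finite list of them can serve as
  the components of a VAS.\<close>

lemma trans_support:
  assumes "(l, d, l') \<in> insert (bonus halt) V" "d c \<noteq> 0"
  shows "case c of X i \<Rightarrow> i < m | Xb i \<Rightarrow> i < m | _ \<Rightarrow> True"
proof -
  have "case c of X i \<Rightarrow> i < m | Xb i \<Rightarrow> i < m | _ \<Rightarrow> True"
    if "(l, d, l') \<in> gadget q a q'" "(q, a, q') \<in> D" for q a q'
    using that(1) regs[OF that(2)] assms(2)
    by (cases a) (auto simp: fun_upd_def split: coord.splits if_splits)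
  with assms show ?thesis
    by (auto simp: vass_def bonus_def guess_vec_def flush_vec_def fun_upd_def
        split: coord.splits if_splits)
qed

end

section \<open>From states to vectors\<close>

text \<open>A location is stored with a parity bit that every transition flips. A transition that
  stays at its location thus still has to consume its token.\<close>

datatype 'q gcoord = Cnt coord | Loc "'q loc" bool

fun enc :: "'q loc \<Rightarrow> bool \<Rightarrow> (coord \<Rightarrow> nat) \<Rightarrow> 'q gcoord \<Rightarrow> nat" where
  "enc l b v (Cnt c) = v c"
| "enc l b v (Loc l' b') = (if l' = l \<and> b' = b then 1 else 0)"

fun lift :: "'q trans \<Rightarrow> bool \<Rightarrow> 'q gcoord \<Rightarrow> int" where
  "lift (l, d, l') b (Cnt c) = d c"
| "lift (l, d, l') b (Loc x p) =
    (if x = l' \<and> p = (\<not> b) then 1 else 0) - (if x = l \<and> p = b then 1 else 0)"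

definition lifts :: "'q trans set \<Rightarrow> ('q gcoord \<Rightarrow> int) set" where
  "lifts S = (\<lambda>(t, b). lift t b) ` (S \<times> UNIV)"

definition astep :: "('c \<Rightarrow> int) set \<Rightarrow> ('c \<Rightarrow> nat) \<Rightarrow> ('c \<Rightarrow> nat) \<Rightarrow> bool" where
  "astep A x y \<longleftrightarrow> (\<exists>d\<in>A. effect d x y)"

lemma asteps_step: "(astep A)\<^sup>*\<^sup>* x y \<Longrightarrow> astep A y z \<Longrightarrow> (astep A)\<^sup>*\<^sup>* x z"
  by (rule rtranclp.rtrancl_into_rtrancl)

lemma asteps_converse_step: "astep A x y \<Longrightarrow> (astep A)\<^sup>*\<^sup>* y z \<Longrightarrow> (astep A)\<^sup>*\<^sup>* x z"
  by (rule converse_rtranclp_into_rtranclp)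

lemma asteps_mono:
  assumes "(astep A)\<^sup>*\<^sup>* x y" "A \<subseteq> B"
  shows "(astep B)\<^sup>*\<^sup>* x y"
proof -
  have "astep A \<le> astep B" using assms(2) by (auto simp: astep_def le_fun_def)
  with assms(1) show ?thesis using rtranclp_mono by blast
qed

lemma lifts_mono: "S \<subseteq> S' \<Longrightarrow> lifts S \<subseteq> lifts S'"
  by (auto simp: lifts_def)

lemma effect_lift_iff:
  "effect (lift (l1, d, l2) p) (enc l b v) w \<longleftrightarrow>
     l1 = l \<and> p = b \<and> (\<exists>v'. effect d v v' \<and> w = enc l2 (\<not> b) v')"
proof
  assume e: "effect (lift (l1, d, l2) p) (enc l b v) w"
  \<comment> \<open>At \<open>Loc l1 p\<close> the displacement is -1: the target entry has the
    other parity and cannot cancel it. The token must therefore lie there in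
    \<open>enc l b v\<close>.\<close>
  then have "int (w (Loc l1 p)) = int (enc l b v (Loc l1 p)) + lift (l1, d, l2) p (Loc l1 p)"
    unfolding effect_def by blast
  then have l: "l1 = l \<and> p = b" by (auto split: if_splits)
  have "effect d v (\<lambda>c. w (Cnt c))"
    unfolding effect_def
  proof
    fix c
    from e have "int (w (Cnt c)) = int (enc l b v (Cnt c)) + lift (l1, d, l2) p (Cnt c)"
      unfolding effect_def by blast
    then show "int (w (Cnt c)) = int (v c) + d c" by simp
  qed
  moreover have "w = enc l2 (\<not> b) (\<lambda>c. w (Cnt c))"
  proof
    fix c
    show "w c = enc l2 (\<not> b) (\<lambda>c. w (Cnt c)) c"
    proof (cases c)
      case (Loc x q)
      from e have "int (w (Loc x q)) = int (enc l b v (Loc x q)) + lift (l1, d, l2) p (Loc x q)"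
        unfolding effect_def by blast
      with l Loc show ?thesis by (auto split: if_splits)
    qed simp
  qed
  ultimately show "l1 = l \<and> p = b \<and> (\<exists>v'. effect d v v' \<and> w = enc l2 (\<not> b) v')"
    using l by blast
next
  assume "l1 = l \<and> p = b \<and> (\<exists>v'. effect d v v' \<and> w = enc l2 (\<not> b) v')"
  then obtain v' where l: "l1 = l" "p = b" and v': "effect d v v'" and w: "w = enc l2 (\<not> b) v'"
    by blast
  show "effect (lift (l1, d, l2) p) (enc l b v) w"
    unfolding effect_def
  proof
    fix c
    show "int (w c) = int (enc l b v c) + lift (l1, d, l2) p c"
      using v' by (cases c) (auto simp: l w effect_def)
  qed
qed

lemma astep_lifts_iff:
  "astep (lifts S) (enc l b v) w \<longleftrightarrow> (\<exists>l' v'. vstep S (l, v) (l', v') \<and> w = enc l' (\<not> b) v')"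
proof
  assume "astep (lifts S) (enc l b v) w"
  then obtain l1 d l2 p where "(l1, d, l2) \<in> S" "effect (lift (l1, d, l2) p) (enc l b v) w"
    by (auto simp: astep_def lifts_def)
  then show "\<exists>l' v'. vstep S (l, v) (l', v') \<and> w = enc l' (\<not> b) v'"
    unfolding effect_lift_iff by (blast intro: vstepI)
next
  assume "\<exists>l' v'. vstep S (l, v) (l', v') \<and> w = enc l' (\<not> b) v'"
  then obtain l' v' d where "(l, d, l') \<in> S" "effect (lift (l, d, l') b) (enc l b v) w"
    by (auto simp: vstep_def effect_lift_iff)
  then show "astep (lifts S) (enc l b v) w"
    by (force simp: astep_def lifts_def)
qed

lemma asteps_lifts_sound:
  assumes "(astep (lifts S))\<^sup>*\<^sup>* (enc l b v) w"
  shows "\<exists>l' b' v'. w = enc l' b' v' \<and> (vstep S)\<^sup>*\<^sup>* (l, v) (l', v')"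
  using assms
proof (induction rule: rtranclp_induct)
  case base
  then show ?case by blast
next
  case (step x y)
  then obtain l' b' v' where x: "x = enc l' b' v'" "(vstep S)\<^sup>*\<^sup>* (l, v) (l', v')" by blast
  with step.hyps(2) obtain l'' v'' where "vstep S (l', v') (l'', v'')" "y = enc l'' (\<not> b') v''"
    by (auto simp: astep_lifts_iff)
  then show ?case using rtranclp.rtrancl_into_rtrancl[OF x(2)] by blast
qed

lemma asteps_lifts_complete:
  assumes "(vstep S)\<^sup>*\<^sup>* (l, v) (l', v')"
  shows "\<exists>b'. (astep (lifts S))\<^sup>*\<^sup>* (enc l b v) (enc l' b' v')"
  using assms
proof (induction l' v' rule: rtranclp_induct2)
  case (step l1 v1 l2 v2)
  then obtain b' where 1: "(astep (lifts S))\<^sup>*\<^sup>* (enc l b v) (enc l1 b' v1)" by blast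
  have "astep (lifts S) (enc l1 b' v1) (enc l2 (\<not> b') v2)"
    using step.hyps(2) by (auto simp: astep_lifts_iff)
  from asteps_step[OF 1 this] show ?case ..
qed blast

section \<open>Vector addition systems over a list of coordinates\<close>

definition mkvas :: "'c list \<Rightarrow> ('c \<Rightarrow> int) list \<Rightarrow> ('c \<Rightarrow> nat) \<Rightarrow> nat vas" where
  "mkvas cs ds x = \<lparr>alphabet = {..<length ds},
     disp = (\<lambda>a\<in>{..<length ds}. map (ds ! a) cs), initial = map x cs\<rparr>"

lemma mkvas_simps [simp]:
  "alphabet (mkvas cs ds x) = {..<length ds}"
  "disp (mkvas cs ds x) = (\<lambda>a\<in>{..<length ds}. map (ds ! a) cs)"
  "initial (mkvas cs ds x) = map x cs"
  "dimension (mkvas cs ds x) = length cs"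
  by (simp_all add: mkvas_def dimension_def)

lemma is_vas_mkvas: "is_vas (mkvas cs ds x)"
  by (auto simp: is_vas_def)

text \<open>The part of the code that is independent of the initial vector, which can therefore hold
  it as an entry.\<close>

definition table :: "'c list \<Rightarrow> ('c \<Rightarrow> int) list \<Rightarrow> nat" where
  "table cs ds = list_encode (map (\<lambda>a. prod_encode (a, list_encode (map int_encode
     ((\<lambda>a\<in>{..<length ds}. map (ds ! a) cs) a)))) (sorted_list_of_set {..<length ds}))"

lemma encode_vas_mkvas: "encode_vas (mkvas cs ds x) = prod_encode (table cs ds, list_encode (map x cs))"
  by (simp add: encode_vas_def table_def)

lemma step_mkvas_iff:
  assumes ds: "\<forall>d\<in>set ds. \<forall>c. c \<notin> set cs \<longrightarrow> d c = 0"
  shows "step (mkvas cs ds x0) (map x cs) a y \<longleftrightarrow>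
    a < length ds \<and> (\<exists>z. effect (ds ! a) x z \<and> y = map z cs)"
proof
  assume s: "step (mkvas cs ds x0) (map x cs) a y"
  then have a: "a < length ds" and len: "length y = length cs"
    and eq: "\<And>i. i \<in> {1..length cs} \<Longrightarrow>
      int (component y i) - int (component (map x cs) i) = component (map (ds ! a) cs) i"
    by (auto simp: step_def)
  have eq': "int (y ! j) = int (x (cs ! j)) + (ds ! a) (cs ! j)" if "j < length cs" for j
    using eq[of "Suc j"] that by (simp add: component_def)
  \<comment> \<open>\<open>z\<close> is computed from \<open>x\<close> and the displacement and not
    read off \<open>y\<close>, so a coordinate listed twice in \<open>cs\<close> causes no
    ambiguity; unlisted coordinates keep their value.\<close>
  define z where "z c = (if c \<in> set cs then nat (int (x c) + (ds ! a) c) else x c)" for c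
  have y: "y ! j = z (cs ! j)" if "j < length cs" for j
    using eq'[OF that] that by (simp add: z_def)
  have "effect (ds ! a) x z"
    unfolding effect_def
  proof
    fix c
    show "int (z c) = int (x c) + (ds ! a) c"
    proof (cases "c \<in> set cs")
      case True
      then obtain j where j: "j < length cs" "c = cs ! j" by (auto simp: in_set_conv_nth)
      with eq'[OF j(1)] y[OF j(1)] show ?thesis by simp
    next
      case False
      with ds a show ?thesis by (simp add: z_def)
    qed
  qed
  moreover have "y = map z cs" using len y by (auto intro: nth_equalityI)
  ultimately show "a < length ds \<and> (\<exists>z. effect (ds ! a) x z \<and> y = map z cs)"
    using a by blast
next
  assume "a < length ds \<and> (\<exists>z. effect (ds ! a) x z \<and> y = map z cs)"
  then show "step (mkvas cs ds x0) (map x cs) a y"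
    by (auto simp: step_def component_def effect_def)
qed

lemma post_star_mkvas:
  assumes ds: "\<forall>d\<in>set ds. \<forall>c. c \<notin> set cs \<longrightarrow> d c = 0"
  shows "post_star (mkvas cs ds x0) = (\<lambda>x. map x cs) ` {x. (astep (set ds))\<^sup>*\<^sup>* x0 x}"
proof -
  let ?V = "mkvas cs ds x0"
  note step = step_mkvas_iff[OF ds]
  have sound: "\<exists>z. (astep (set ds))\<^sup>*\<^sup>* x z \<and> y = map z cs" if "run ?V (map x cs) u y" for x u y
    using that
  proof (induction u arbitrary: x)
    case Nil
    then show ?case by auto
  next
    case (Cons a u)
    then obtain w where w: "a < length ds" "effect (ds ! a) x w" "run ?V (map w cs) u y"
      by (auto simp: step)
    then have "astep (set ds) x w" by (auto simp: astep_def)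
    with Cons.IH[OF w(3)] show ?case by (blast intro: asteps_converse_step)
  qed
  have complete: "\<exists>u\<in>lists {..<length ds}. run ?V (map x cs) u (map z cs)"
    if "(astep (set ds))\<^sup>*\<^sup>* x z" for x z
    using that
  proof (induction rule: converse_rtranclp_induct)
    case base
    show ?case by (rule bexI[of _ "[]"]) auto
  next
    case (step x w)
    then obtain a where a: "a < length ds" "effect (ds ! a) x w"
      by (auto simp: astep_def in_set_conv_nth)
    then have "step ?V (map x cs) a (map w cs)" by (auto simp: step_mkvas_iff[OF ds])
    with step.IH a(1) show ?case by (auto intro!: bexI[of _ "a # _"])
  qed
  show ?thesis
    unfolding post_star_def using sound complete by fastforce
qed

section \<open>The closure order on embedded vectors\<close>

lemma le_on_refl: "le_on P x x"
  by (simp add: le_on_def)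

lemma le_on_trans: "le_on P x y \<Longrightarrow> le_on P y z \<Longrightarrow> le_on P x z"
  unfolding le_on_def by (auto split: if_splits intro: order_trans)

lemma down_closure_subsetI:
  "(\<And>x. x \<in> A \<Longrightarrow> \<exists>y\<in>B. le_on P x y) \<Longrightarrow> down_closure P A \<subseteq> down_closure P B"
  unfolding down_closure_def by (blast intro: le_on_trans)

lemma le_on_first_iff:
  "le_on {1} (embed_omega (map x (c # cs))) (embed_omega (map y (c # cs))) \<longleftrightarrow>
    x c = y c \<and> (\<forall>c'\<in>set cs. x c' \<le> y c')"
proof
  assume L: "le_on {1} (embed_omega (map x (c # cs))) (embed_omega (map y (c # cs)))"
  moreover have "1 \<in> {1..length (embed_omega (map x (c # cs)))}"
    by (simp add: embed_omega_def)
  ultimately have "component (embed_omega (map x (c # cs))) 1 = component (embed_omega (map y (c # cs))) 1"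
    unfolding le_on_def by fastforce
  then have "x c = y c" by (simp add: embed_omega_def component_def)
  moreover have "x (cs ! j) \<le> y (cs ! j)" if j: "j < length cs" for j
  proof -
    \<comment> \<open>Components are numbered from 1 and the head is the first, so index
      \<open>j\<close> of \<open>cs\<close> is component \<open>j + 2\<close>.\<close>
    have "Suc (Suc j) \<in> {1..length (embed_omega (map x (c # cs)))}"
      using j by (simp add: embed_omega_def)
    with L have "component (embed_omega (map x (c # cs))) (Suc (Suc j))
        \<le> component (embed_omega (map y (c # cs))) (Suc (Suc j))"
      unfolding le_on_def by fastforce
    with j show ?thesis by (simp add: embed_omega_def component_def)
  qed
  ultimately show "x c = y c \<and> (\<forall>c'\<in>set cs. x c' \<le> y c')"
    by (simp add: all_set_conv_all_nth)
next
  assume R: "x c = y c \<and> (\<forall>c'\<in>set cs. x c' \<le> y c')"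
  show "le_on {1} (embed_omega (map x (c # cs))) (embed_omega (map y (c # cs)))"
    unfolding le_on_def
  proof (intro conjI ballI)
    fix i assume "i \<in> {1..length (embed_omega (map x (c # cs)))}"
    then obtain j where j: "i = Suc j" "j \<le> length cs"
      by (cases i) (auto simp: embed_omega_def)
    show "if i \<in> {1} then
        component (embed_omega (map x (c # cs))) i = component (embed_omega (map y (c # cs))) i
        else component (embed_omega (map x (c # cs))) i \<le> component (embed_omega (map y (c # cs))) i"
      using R j by (cases j) (auto simp: embed_omega_def component_def)
  qed (simp add: embed_omega_def)
qed

section \<open>The diagonal argument\<close>

fun coms :: "com \<Rightarrow> com set" where
  "coms Skip = {Skip}"
| "coms (Act a) = {Act a, Skip}"
| "coms (Seq c d) = (\<lambda>c'. Seq c' d) ` coms c \<union> coms d"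
| "coms (While r c) = {While r c, Skip} \<union> (\<lambda>c'. Seq c' (While r c)) ` coms c"

lemma finite_coms: "finite (coms c)"
  by (induction c) auto

lemma coms_self: "c \<in> coms c"
  by (induction c) auto

text \<open>Entering a loop makes the program grow, but each residual of the body is followed by the
  same loop, so a finite set of programs is closed under steps.\<close>

lemma coms_step: "c' \<in> coms c \<Longrightarrow> cstep c' a c'' \<Longrightarrow> c'' \<in> coms c"
proof (induction c arbitrary: c' c'')
  case (Seq c d)
  from Seq.prems(1) consider x where "x \<in> coms c" "c' = Seq x d" | "c' \<in> coms d" by auto
  then show ?case
  proof cases
    case 1
    with Seq.prems(2) Seq.IH(1)[OF 1(1)] coms_self[of d] show ?thesis
      by (auto elim!: cstep_SeqE)
  next
    case 2
    with Seq.IH(2) Seq.prems(2) show ?thesis by simp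
  qed
next
  case (While r c)
  from While.prems(1) consider "c' = While r c" | "c' = Skip"
    | x where "x \<in> coms c" "c' = Seq x (While r c)" by auto
  then show ?case
  proof cases
    case 1
    with While.prems(2) coms_self[of c] show ?thesis by (auto elim!: cstep_WhileE)
  next
    case 2
    with While.prems(2) show ?thesis by (auto elim: cstep_SkipE)
  next
    case 3
    with While.prems(2) While.IH[OF 3(1)] show ?thesis by (auto elim!: cstep_SeqE)
  qed
qed (auto elim: cstep_SkipE cstep_ActE)

lemma finite_cstep: "finite {(a, c'). cstep c a c'}"
proof (induction c)
  case Skip
  have "{(a, c'). cstep Skip a c'} = {}" by (auto elim: cstep_SkipE)
  then show ?case by simp
next
  case (Act a)
  have "{(b, c'). cstep (Act a) b c'} \<subseteq> {(a, Skip)}" by (auto elim: cstep_ActE)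
  then show ?case by (rule finite_subset) simp
next
  case (Seq c d)
  have "{(a, c'). cstep (Seq c d) a c'} \<subseteq>
      insert (Nop, d) ((\<lambda>(a, c'). (a, Seq c' d)) ` {(a, c'). cstep c a c'})"
    by (auto elim!: cstep_SeqE)
  then show ?case by (rule finite_subset) (use Seq.IH(1) in simp)
next
  case (While r c)
  have "{(a, c'). cstep (While r c) a c'} \<subseteq> {(IsZ r, Skip), (Decr r, Seq c (While r c))}"
    by (auto elim: cstep_WhileE)
  then show ?case by (rule finite_subset) simp
qed

text \<open>The state \<open>None\<close> only tests a register that is zero from the beginning. It provides honest
  configurations in which all the available tests are used up, whether or not \<open>c\<close> halts.\<close>

definition machine :: "nat \<Rightarrow> com \<Rightarrow> (com option \<times> act \<times> com option) set" where
  "machine z c = {(Some c1, a, Some c2) | c1 a c2. c1 \<in> coms c \<and> cstep c1 a c2} \<union>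
     {(None, IsZ z, None), (Some Skip, IsZ z, Some Skip)}"

lemma finite_machine: "finite (machine z c)"
proof -
  have "{(Some c1, a, Some c2) | c1 a c2. c1 \<in> coms c \<and> cstep c1 a c2} =
      (\<Union>c1\<in>coms c. (\<lambda>(a, c2). (Some c1, a, Some c2)) ` {(a, c2). cstep c1 a c2})"
    by auto
  also have "finite \<dots>" using finite_coms finite_cstep by blast
  finally show ?thesis by (simp add: machine_def)
qed

lemma machine_complete:
  assumes "prog_step\<^sup>*\<^sup>* (c, s) (d, t)"
  shows "(mstep (machine z c))\<^sup>*\<^sup>* (Some c, s) (Some d, t) \<and> d \<in> coms c"
  using assms
proof (induction d t rule: rtranclp_induct2)
  case refl
  show ?case by (simp add: coms_self)
next
  case (step d t e u)
  from step.hyps(2) obtain a where a: "cstep d a e" "act_rel a t u" by (auto simp: mstep_def)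
  with step.IH have "mstep (machine z c) (Some d, t) (Some e, u)"
    by (auto simp: mstep_def machine_def)
  with step.IH coms_step[OF _ a(1)] show ?case by (meson rtranclp.rtrancl_into_rtrancl)
qed

lemma machine_sound:
  assumes "(mstep (machine z c))\<^sup>*\<^sup>* (Some c, s) (q, t)"
  shows "\<exists>d. q = Some d \<and> prog_step\<^sup>*\<^sup>* (c, s) (d, t)"
  using assms
proof (induction q t rule: rtranclp_induct2)
  case refl
  show ?case by simp
next
  case (step q t q' u)
  then obtain d where d: "q = Some d" "prog_step\<^sup>*\<^sup>* (c, s) (d, t)" by blast
  from step.hyps(2) obtain a where a: "(q, a, q') \<in> machine z c" "act_rel a t u"
    by (auto simp: mstep_def)
  show ?case
  \<comment> \<open>The loop at \<open>Some Skip\<close> is the only transition from a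
    \<open>Some\<close> state that is not a program step, and it changes neither state nor
    store.\<close>
  proof (cases "q' = q \<and> u = t")
    case True
    with d show ?thesis by blast
  next
    case False
    with a d obtain e where "q' = Some e" "cstep d a e" by (auto simp: machine_def)
    with a(2) have "prog_step (d, t) (e, u)" by (auto simp: mstep_def)
    with d(2) have "prog_step\<^sup>*\<^sup>* (c, s) (e, u)" by (rule rtranclp.rtrancl_into_rtrancl)
    with \<open>q' = Some e\<close> show ?thesis by blast
  qed
qed

text \<open>Registers 0 to 3 hold the input, 4 the answer, and scratch starts at 5. The last action
  blocks on answer 0 and turns answer 1 into 0, so register 4 is zero before and after a halting run
  and can serve as the register \<open>z\<close>.\<close>

definition decision_prog :: "recf \<Rightarrow> com" where
  "decision_prog f = Seq (compile f [0, 1, 2, 3] 4 5) (Act (Decr 4))"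

lemma decision_prog_halts:
  assumes "rec_eval f (map s [0, 1, 2, 3]) 1" "\<And>i. 4 \<le> i \<Longrightarrow> s i = 0"
  shows "prog_step\<^sup>*\<^sup>* (decision_prog f, s) (Skip, s)"
proof -
  have "runs (compile f [0, 1, 2, 3] 4 5) s (s(4 := 1))"
    by (rule compile_correctD[OF compile_correct assms(1)]) (use assms(2) in auto)
  moreover have "runs (Act (Decr 4)) (s(4 := 1)) s"
    using assms(2)[of 4] by (intro runs_Act) auto
  ultimately show ?thesis
    using runs_Seq unfolding decision_prog_def runs_def[symmetric] by blast
qed

lemma decision_prog_diverges:
  assumes "rec_eval f (map s [0, 1, 2, 3]) 0" "\<And>i. 4 \<le> i \<Longrightarrow> s i = 0"
  shows "\<not> prog_step\<^sup>*\<^sup>* (decision_prog f, s) (Skip, t)"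
proof
  assume halt: "prog_step\<^sup>*\<^sup>* (decision_prog f, s) (Skip, t)"
  have "runs (compile f [0, 1, 2, 3] 4 5) s (s(4 := 0))"
    by (rule compile_correctD[OF compile_correct assms(1)]) (use assms(2) in auto)
  then have *: "prog_step\<^sup>*\<^sup>* (decision_prog f, s) (Act (Decr 4), s(4 := 0))"
    unfolding decision_prog_def by (rule prog_steps_Seq)
  have "(Act (Decr 4), s(4 := 0)) = (Skip, t)"
  proof (rule deterministic_stuck_unique[OF prog_step_deterministic * halt])
    show "\<not> prog_step (Act (Decr 4), s(4 := 0)) w" for w
      by (auto simp: mstep_def elim: cstep_ActE)
    show "\<not> prog_step (Skip, t) w" for w
      by (auto simp: mstep_def elim: cstep_SkipE)
  qed
  then show False by simp
qed

section \<open>Comparison of the two closures\<close>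

context budget_machine
begin

abbreviation init_enc :: "'q gcoord \<Rightarrow> nat" where
  "init_enc \<equiv> enc Guess False (conf m s0 k0 k0 0)"

text \<open>\<open>Fin\<close> is never left, so a run that has used the bonus ends there; the
  invariant applies to it because the program does not halt.\<close>

lemma bonus_asteps_cases:
  assumes "\<not> halts" "(astep (lifts (insert (bonus halt) V)))\<^sup>*\<^sup>* init_enc x"
  shows "(astep (lifts V))\<^sup>*\<^sup>* init_enc x \<or>
    (\<exists>b v. x = enc Fin b v \<and> k0 \<le> v K \<and> v Y \<le> 2 * v K * v K)"
proof -
  let ?V = "insert (bonus halt) V"
  have "(astep (lifts V))\<^sup>*\<^sup>* init_enc x \<or> (\<exists>b v. x = enc Fin b v)"
    using assms(2)
  proof (induction rule: rtranclp_induct)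
    case base
    then show ?case by blast
  next
    case (step x y)
    from asteps_lifts_sound[OF step.hyps(1)] obtain l b v where x: "x = enc l b v" by blast
    with step.hyps(2) obtain l' v' where y: "vstep ?V (l, v) (l', v')" "y = enc l' (\<not> b) v'"
      by (auto simp: astep_lifts_iff)
    show ?case
    proof (cases "vstep V (l, v) (l', v')")
      case True
      then have xy: "astep (lifts V) x y" using x y(2) by (auto simp: astep_lifts_iff)
      from step.IH show ?thesis
      proof
        assume "(astep (lifts V))\<^sup>*\<^sup>* init_enc x"
        from asteps_step[OF this xy] show ?thesis ..
      next
        assume "\<exists>b v. x = enc Fin b v"
        then obtain b2 v2 where "x = enc Fin b2 v2" by blast
        with xy obtain l2 v3 where "vstep V (Fin, v2) (l2, v3)" "y = enc l2 (\<not> b2) v3"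
          by (auto simp: astep_lifts_iff)
        with vstep_Fin show ?thesis by blast
      qed
    next
      case False
      with y(1) have "l' = Fin" by (auto simp: vstep_def bonus_def)
      with y(2) show ?thesis by blast
    qed
  qed
  moreover have "k0 \<le> v K \<and> v Y \<le> 2 * v K * v K" if "x = enc Fin b v" for b v
  proof -
    from asteps_lifts_sound[OF assms(2)] obtain l' b' v' where
      x: "x = enc l' b' v'" and r: "(vstep ?V)\<^sup>*\<^sup>* init (l', v')" by blast
    have "v = v'" using x that by (metis enc.simps(1) ext)
    with inv_reachable[OF order_refl _ r] inv_Y_le[of l' v'] inv_K_ge[of l' v'] assms(1)
    show ?thesis by blast
  qed
  ultimately show ?thesis by blast
qed

text \<open>Tokens are compared as components too, so the parity \<open>b\<close> is prescribed; one
  more flush corrects it when necessary.\<close>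

lemma asteps_covers:
  assumes "k0 \<le> k"
  shows "\<exists>w. (astep (lifts V))\<^sup>*\<^sup>* init_enc (enc Fin b w) \<and> covers k n w"
proof -
  from reach_covers[OF assms] obtain w w' where
    w: "(vstep V)\<^sup>*\<^sup>* init (Fin, w)" "vstep V (Fin, w) (Fin, w')" "covers k n w" "covers k n w'"
    by blast
  from asteps_lifts_complete[OF w(1)] obtain b' where
    b': "(astep (lifts V))\<^sup>*\<^sup>* init_enc (enc Fin b' w)" by blast
  have "astep (lifts V) (enc Fin b' w) (enc Fin (\<not> b') w')"
    using w(2) by (auto simp: astep_lifts_iff)
  from b' asteps_step[OF b' this] w(3,4) show ?thesis by (cases "b = b'") auto
qed

text \<open>A halting program yields \<open>Y = 2 * K * K + 1\<close>, which the invariant excludes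
  in the second system for the same \<open>K\<close>. Otherwise every vector gained by the bonus
  lies at \<open>Fin\<close> within the bound and is dominated by a flushed vector.\<close>

lemma down_closure_eq_iff:
  assumes ds1: "set ds1 = lifts (insert (bonus halt) V)" and ds2: "set ds2 = lifts V"
    and supp: "\<forall>d\<in>set ds1. \<forall>c. c \<notin> set (Cnt K # cs) \<longrightarrow> d c = 0"
    and Y: "Cnt Y \<in> set cs"
    and cs: "\<And>i. Cnt (X i) \<in> set cs \<Longrightarrow> i < m" "\<And>i. Cnt (Xb i) \<in> set cs \<Longrightarrow> i < m"
    and z: "halts \<Longrightarrow> \<exists>s. (mstep D)\<^sup>*\<^sup>* (start, s0) (halt, s) \<and> s z = 0"
  shows "down_closure {1} (embed_omega ` post_star (mkvas (Cnt K # cs) ds1 init_enc)) =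
      down_closure {1} (embed_omega ` post_star (mkvas (Cnt K # cs) ds2 init_enc)) \<longleftrightarrow> \<not> halts"
proof -
  let ?cs = "Cnt K # cs"
  let ?e = "\<lambda>x. embed_omega (map x ?cs)"
  let ?R = "\<lambda>S. {x. (astep (lifts S))\<^sup>*\<^sup>* init_enc x}"
  let ?V = "insert (bonus halt) V"
  have "set ds2 \<subseteq> set ds1" unfolding ds1 ds2 by (rule lifts_mono) auto
  with supp have supp2: "\<forall>d\<in>set ds2. \<forall>c. c \<notin> set ?cs \<longrightarrow> d c = 0" by blast
  have post: "embed_omega ` post_star (mkvas ?cs ds1 init_enc) = ?e ` ?R ?V"
    "embed_omega ` post_star (mkvas ?cs ds2 init_enc) = ?e ` ?R V"
    unfolding post_star_mkvas[OF supp] post_star_mkvas[OF supp2] image_image ds1 ds2 by simp_all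
  have "down_closure {1} (?e ` ?R ?V) = down_closure {1} (?e ` ?R V) \<longleftrightarrow> \<not> halts"
  proof
    assume eq: "down_closure {1} (?e ` ?R ?V) = down_closure {1} (?e ` ?R V)"
    show "\<not> halts"
    proof
      assume halts
      with z reach_bonus obtain w where
        w: "(vstep ?V)\<^sup>*\<^sup>* init (Fin, w)" "w Y = Suc (2 * w K * w K)" by blast
      from asteps_lifts_complete[OF w(1)] obtain b where
        "(astep (lifts ?V))\<^sup>*\<^sup>* init_enc (enc Fin b w)" by blast
      then have "?e (enc Fin b w) \<in> down_closure {1} (?e ` ?R ?V)"
        unfolding down_closure_def using le_on_refl by blast
      then obtain y where y: "(astep (lifts V))\<^sup>*\<^sup>* init_enc y" "le_on {1} (?e (enc Fin b w)) (?e y)"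
        unfolding eq by (auto simp: down_closure_def)
      from asteps_lifts_sound[OF y(1)] obtain l b' v where
        v: "y = enc l b' v" "(vstep V)\<^sup>*\<^sup>* init (l, v)" by blast
      \<comment> \<open>The program halts in this case, so the invariant is available only for a
        system without the bonus. In \<open>V\<close> only \<open>park\<close> leads from an
        \<open>At\<close> location to \<open>Fin\<close>.\<close>
      have "bonus halt \<notin> V"
      proof
        assume "bonus halt \<in> V"
        moreover have "bonus halt \<notin> gadget q a q'" for q a q'
          by (cases a) (auto simp: bonus_def)
        ultimately show False using park_ne_halt by (auto simp: vass_def bonus_def)
      qed
      then have "inv (l, v)" using inv_reachable[of V "(l, v)"] v(2) by auto
      then have "v Y \<le> 2 * v K * v K" by (rule inv_Y_le)
      moreover have "w K = v K" "w Y \<le> v Y"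
        using y(2) Y unfolding v(1) le_on_first_iff by auto
      ultimately show False using w(2) by simp
    qed
  next
    assume nh: "\<not> halts"
    have "down_closure {1} (?e ` ?R ?V) \<subseteq> down_closure {1} (?e ` ?R V)"
    proof (rule down_closure_subsetI)
      fix u assume "u \<in> ?e ` ?R ?V"
      then obtain x where x: "u = ?e x" "(astep (lifts ?V))\<^sup>*\<^sup>* init_enc x" by blast
      from bonus_asteps_cases[OF nh x(2)]
      show "\<exists>y\<in>?e ` ?R V. le_on {1} u y"
      proof
        assume "(astep (lifts V))\<^sup>*\<^sup>* init_enc x"
        then show ?thesis using x(1) le_on_refl by blast
      next
        assume "\<exists>b v. x = enc Fin b v \<and> k0 \<le> v K \<and> v Y \<le> 2 * v K * v K"
        then obtain b v where v: "x = enc Fin b v" "k0 \<le> v K" "v Y \<le> 2 * v K * v K" by blast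
        \<comment> \<open>A common bound for all counters of \<open>v\<close> that flushing can
          raise.\<close>
        define n where "n = v T + (\<Sum>i<m. v (X i) + v (Xb i))"
        from asteps_covers[OF v(2)] obtain w where
          w: "(astep (lifts V))\<^sup>*\<^sup>* init_enc (enc Fin b w)" "covers (v K) n w" by blast
        have n: "v (X i) \<le> n \<and> v (Xb i) \<le> n" if "i < m" for i
          using member_le_sum[of i "{..<m}" "\<lambda>i. v (X i) + v (Xb i)"] that by (auto simp: n_def)
        have "enc Fin b v c \<le> enc Fin b w c" if c: "c \<in> set cs" for c
        proof (cases c)
          case (Cnt c')
          have "v c' \<le> w c'"
          proof (cases c')
            case (X i)
            then have "i < m" using cs c Cnt by blast
            with X n w(2) show ?thesis by (auto simp: covers_def intro: order_trans)
          next
            case (Xb i)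
            then have "i < m" using cs c Cnt by blast
            with Xb n w(2) show ?thesis by (auto simp: covers_def intro: order_trans)
          qed (use v(3) w(2) in \<open>auto simp: covers_def n_def\<close>)
          with Cnt show ?thesis by simp
        qed simp
        then have "le_on {1} u (?e (enc Fin b w))"
          using w(2) unfolding x(1) v(1) le_on_first_iff by (auto simp: covers_def)
        with w(1) show ?thesis by blast
      qed
    qed
    moreover have "down_closure {1} (?e ` ?R V) \<subseteq> down_closure {1} (?e ` ?R ?V)"
    proof (rule down_closure_subsetI)
      fix u assume "u \<in> ?e ` ?R V"
      then obtain x where x: "u = ?e x" "(astep (lifts V))\<^sup>*\<^sup>* init_enc x" by blast
      have "(astep (lifts ?V))\<^sup>*\<^sup>* init_enc x"
        using x(2) by (rule asteps_mono) (auto simp: lifts_def)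
      then show "\<exists>y\<in>?e ` ?R ?V. le_on {1} u y" using x(1) le_on_refl by blast
    qed
    ultimately show "down_closure {1} (?e ` ?R ?V) = down_closure {1} (?e ` ?R V)" by blast
  qed
  then show ?thesis unfolding post .
qed

end

section \<open>Layout and code of the initial vector\<close>

lemma finite_gadget: "finite (gadget q a q')"
  by (cases a) auto

lemma finite_vass: "finite D \<Longrightarrow> finite (vass D m start park)"
  unfolding vass_def by (simp add: finite_gadget split_beta)

lemma finite_lifts: "finite S \<Longrightarrow> finite (lifts S)"
  by (simp add: lifts_def)

text \<open>The number of coordinates depends on the program that has to compute the code of the initial
  vector. Its constant blocks therefore come last, and their lengths \<open>n1\<close> and \<open>n2\<close> are inputs.\<close>

definition init_list :: "nat \<Rightarrow> nat \<Rightarrow> nat \<Rightarrow> nat \<Rightarrow> nat list" where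
  "init_list a b n1 n2 = (let k = a + b + n1 + n2 in
     [k, 0, k, a, b, n1, n2, b + n1 + n2, a + n1 + n2, a + b + n2, a + b + n1, 1] @
     replicate n1 k @ replicate n2 0)"

text \<open>Both systems share the initial vector, so its code \<open>l\<close> occurs twice;
  \<open>a\<close> and \<open>b\<close> are to be the codes of the two transition tables.\<close>

definition pair_code :: "nat \<Rightarrow> nat \<Rightarrow> nat \<Rightarrow> nat \<Rightarrow> nat" where
  "pair_code a b n1 n2 = (let l = list_encode (init_list a b n1 n2) in
     prod_encode (prod_encode (a, l), prod_encode (b, l)))"

lemma computable_pair_code:
  "computable 4 (\<lambda>xs. pair_code (xs ! 0) (xs ! 1) (xs ! 2) (xs ! 3))"
proof -
  have nil: "computable 4 (\<lambda>xs. list_encode [])" by (simp add: computable_zero)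
  have nth: "computable 4 (\<lambda>xs. xs ! 0)" "computable 4 (\<lambda>xs. xs ! 1)"
    "computable 4 (\<lambda>xs. xs ! 2)" "computable 4 (\<lambda>xs. xs ! 3)"
    by (rule computable_nth, simp)+
  have one: "computable 4 (\<lambda>xs. 1)"
    using computable_Suc[OF computable_zero, of 4] by simp
  have zeros: "computable 4 (\<lambda>xs. list_encode (replicate (xs ! 3) 0))"
    using computable_list_encode_replicate_append[OF nth(4) computable_zero nil] by simp
  have sum: "computable 4 (\<lambda>xs. xs ! 0 + xs ! 1 + xs ! 2 + xs ! 3)"
    by (intro computable_add nth)
  have tail: "computable 4 (\<lambda>xs. list_encode
      (replicate (xs ! 2) (xs ! 0 + xs ! 1 + xs ! 2 + xs ! 3) @ replicate (xs ! 3) 0))"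
    by (rule computable_list_encode_replicate_append[OF nth(3) sum zeros])
  have "computable 4 (\<lambda>xs. list_encode (init_list (xs ! 0) (xs ! 1) (xs ! 2) (xs ! 3)))"
    unfolding init_list_def Let_def append_Cons append_Nil
    by (rule computable_list_encode_Cons, (intro computable_add computable_zero one nth))+
      (rule tail)
  then show ?thesis
    unfolding pair_code_def Let_def by (intro computable_prod_encode nth)
qed

text \<open>The order follows the entries of \<open>init_list\<close>. \<open>Cnt K\<close> is put
  in front later, as the component compared exactly.\<close>

definition coords :: "nat \<Rightarrow> 'q gcoord list \<Rightarrow> 'q gcoord list" where
  "coords m zs = [Cnt Y, Cnt T, Cnt (X 0), Cnt (X 1), Cnt (X 2), Cnt (X 3),
     Cnt (Xb 0), Cnt (Xb 1), Cnt (Xb 2), Cnt (Xb 3), Loc Guess False] @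
     map (\<lambda>i. Cnt (Xb i)) [4..<m] @ zs"

text \<open>All remaining coordinates. They start at 0, so their order in \<open>zs\<close> does not
  affect the initial vector.\<close>

definition zero_coords :: "nat \<Rightarrow> 'q trans set \<Rightarrow> 'q gcoord set" where
  "zero_coords m S = (\<lambda>i. Cnt (X i)) ` {4..<m} \<union>
     {Loc l p | l p. l \<in> fst ` S \<union> (snd \<circ> snd) ` S \<and> (l, p) \<noteq> (Guess, False)}"

lemma finite_zero_coords:
  assumes "finite S"
  shows "finite (zero_coords m S)"
proof -
  have "{Loc l p | l p. l \<in> fst ` S \<union> (snd \<circ> snd) ` S \<and> (l, p) \<noteq> (Guess, False)}
      \<subseteq> (\<lambda>(l, p). Loc l p) ` ((fst ` S \<union> (snd \<circ> snd) ` S) \<times> UNIV)"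
    by auto
  then have "finite {Loc l p | l p. l \<in> fst ` S \<union> (snd \<circ> snd) ` S \<and> (l, p) \<noteq> (Guess, False)}"
    by (rule finite_subset) (use assms in simp)
  then show ?thesis by (simp add: zero_coords_def)
qed

definition input :: "nat list \<Rightarrow> nat \<Rightarrow> nat" where
  "input xs i = (if i < length xs then xs ! i else 0)"

lemma input_simps:
  "input [a, b, c, d] 0 = a" "input [a, b, c, d] (Suc 0) = b" "input [a, b, c, d] 2 = c"
  "input [a, b, c, d] 3 = d" "4 \<le> i \<Longrightarrow> input [a, b, c, d] i = 0"
  by (simp_all add: input_def)

lemma map_init_enc:
  assumes m: "m = n + 4" and zs: "set zs = zero_coords m S"
    and k: "k = a + b + n + length zs" and s: "s = input [a, b, n, length zs]"
  shows "map (enc Guess False (conf m s k k 0)) (Cnt K # coords m zs) =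
    init_list a b n (length zs)"
proof -
  let ?v = "enc Guess False (conf m s k k 0)"
  have "?v c = 0" if "c \<in> set zs" for c
    using that unfolding zs zero_coords_def s by (auto simp: input_simps)
  then have "map ?v zs = map (\<lambda>_. 0) zs" by (rule map_cong[OF refl])
  then have 1: "map ?v zs = replicate (length zs) 0" unfolding map_replicate_const .
  have "?v (Cnt (Xb i)) = k" if "i \<in> set [4..<m]" for i
    using that by (simp add: s input_simps)
  then have "map (\<lambda>i. ?v (Cnt (Xb i))) [4..<m] = map (\<lambda>_. k) [4..<m]"
    by (rule map_cong[OF refl])
  then have 2: "map (\<lambda>i. ?v (Cnt (Xb i))) [4..<m] = replicate n k"
    by (simp add: map_replicate_const m)
  \<comment> \<open>The complement \<open>k - a\<close> appears in \<open>init_list\<close> as the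
    sum of the other three inputs, and likewise for the rest, so additions suffice to compute
    it.\<close>
  show ?thesis
    unfolding coords_def init_list_def map_append list.map map_map comp_def 1 2 Let_def k[symmetric]
    by (simp add: s input_simps m) (simp add: k)
qed

lemma coords_regs:
  assumes "set zs = zero_coords m S" "4 \<le> m"
  shows "Cnt (X i) \<in> set (coords m zs) \<Longrightarrow> i < m" "Cnt (Xb i) \<in> set (coords m zs) \<Longrightarrow> i < m"
  unfolding coords_def set_append assms(1) zero_coords_def using assms(2) by auto

lemma (in budget_machine) lifts_support:
  assumes "d \<in> lifts (insert (bonus halt) V)" "set zs = zero_coords m (insert (bonus halt) V)"
    "c \<notin> set (Cnt K # coords m zs)"
  shows "d c = 0"
proof -
  from assms(1) obtain l e l' p where t: "(l, e, l') \<in> insert (bonus halt) V" and d: "d = lift (l, e, l') p"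
    unfolding lifts_def by auto
  show ?thesis
  proof (cases c)
    case (Cnt c')
    have lt4: "i = 0 \<or> i = 1 \<or> i = 2 \<or> i = 3 \<or> 4 \<le> i" for i :: nat by auto
    have "e c' = 0"
    proof (rule ccontr)
      assume "e c' \<noteq> 0"
      note supp = trans_support[OF t this]
      show False
      proof (cases c')
        case (X i)
        with supp lt4[of i] assms(2,3) Cnt show False by (auto simp: coords_def zero_coords_def)
      next
        case (Xb i)
        with supp lt4[of i] assms(3) Cnt show False by (auto simp: coords_def)
      qed (use assms(3) Cnt in \<open>simp_all add: coords_def\<close>)
    qed
    with d Cnt show ?thesis by simp
  next
    case (Loc x q)
    have "(x, q) \<noteq> (Guess, False)" using assms(3) Loc by (auto simp: coords_def)
    moreover have "c \<notin> zero_coords m (insert (bonus halt) V)"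
      using assms(2,3) by (auto simp: coords_def)
    ultimately have "x \<notin> fst ` insert (bonus halt) V \<union> (snd \<circ> snd) ` insert (bonus halt) V"
      unfolding zero_coords_def Loc by blast
    moreover have "l \<in> fst ` insert (bonus halt) V" "l' \<in> (snd \<circ> snd) ` insert (bonus halt) V"
      using image_eqI[OF _ t, of _ fst] image_eqI[OF _ t, of _ "snd \<circ> snd"] by simp_all
    ultimately have "x \<noteq> l" "x \<noteq> l'" by blast+
    with d Loc show ?thesis by simp
  qed
qed

theorem theorem5p1:
  "\<not> decidable_on encode_vas_pair vas_pairs
     {(V1, V2). down_closure {1} (embed_omega ` post_star V1) = down_closure {1} (embed_omega ` post_star V2)}"
proof
  let ?E = "{(V1, V2). down_closure {1} (embed_omega ` post_star V1) =
    down_closure {1} (embed_omega ` post_star V2)}"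
  assume "decidable_on encode_vas_pair vas_pairs ?E"
  then obtain f where
    f: "\<And>x. x \<in> vas_pairs \<Longrightarrow> rec_eval f [encode_vas_pair x] (if x \<in> ?E then 1 else 0)"
    unfolding decidable_on_def by blast
  from computable_pair_code obtain e where
    e: "\<And>xs. length xs = 4 \<Longrightarrow> rec_eval e xs (pair_code (xs ! 0) (xs ! 1) (xs ! 2) (xs ! 3))"
    unfolding computable_def by blast
  define F where "F = Comp f [e]"
  define P where "P = decision_prog F"
  define D where "D = machine 4 P"
  have "finite D" unfolding D_def by (rule finite_machine)
  have "finite (act_regs a)" for a by (cases a) auto
  \<comment> \<open>Inserting 4 ensures \<open>4 < m\<close>, so the truncated difference
    \<open>m - 4\<close> below is exact.\<close>
  with \<open>finite D\<close> have "finite (insert 4 (\<Union>(q, a, q')\<in>D. act_regs a))" by auto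
  then obtain m where m: "\<And>i. i \<in> insert 4 (\<Union>(q, a, q')\<in>D. act_regs a) \<Longrightarrow> i < m"
    by (meson finite_nat_set_iff_bounded)
  define n where "n = m - 4"
  have m4: "m = n + 4" using m[of 4] by (simp add: n_def)
  define V where "V = vass D m (Some P) None"
  define V' where "V' = insert (bonus (Some Skip)) V"
  have fin: "finite V" "finite V'"
    using finite_vass[OF \<open>finite D\<close>] by (simp_all add: V_def V'_def)
  from finite_list[OF finite_lifts[OF fin(1)]] obtain ds2 where ds2: "set ds2 = lifts V" by blast
  from finite_list[OF finite_lifts[OF fin(2)]] obtain ds1 where ds1: "set ds1 = lifts V'" by blast
  from finite_list[OF finite_zero_coords[OF fin(2)]] obtain zs where
    zs: "set zs = zero_coords m V'" by blast
  define cs where "cs = coords m zs"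
  \<comment> \<open>The self-reference closes here: the tables are determined by the program and the
    coordinates alone, so they can now become its input.\<close>
  define a where "a = table (Cnt K # cs) ds1"
  define b where "b = table (Cnt K # cs) ds2"
  define s0 where "s0 = input [a, b, n, length zs]"
  \<comment> \<open>The sum bounds each input and is computable by additions.\<close>
  define k0 where "k0 = a + b + n + length zs"
  interpret budget_machine D m "Some P" None "Some Skip" s0 k0 4
  proof
    show "i < m" if "(q, a, q') \<in> D" "i \<in> act_regs a" for q a q' i
      using m that by blast
    show "s0 i \<le> k0" for i
      by (auto simp: s0_def k0_def input_def nth_Cons' less_Suc_eq)
    show "(None, IsZ 4, None) \<in> D" "(Some Skip, IsZ 4, Some Skip) \<in> D"
      by (simp_all add: D_def machine_def)
    show "a = IsZ 4 \<and> q = None" if "(None, a, q) \<in> D" for a q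
      using that by (simp add: D_def machine_def)
    show "s0 4 = 0" by (simp add: s0_def input_simps)
  qed simp
  let ?V1 = "mkvas (Cnt K # cs) ds1 init_enc" and ?V2 = "mkvas (Cnt K # cs) ds2 init_enc"
  have init: "map init_enc (Cnt K # cs) = init_list a b (n) (length zs)"
    unfolding cs_def by (rule map_init_enc[OF m4 zs k0_def s0_def])
  \<comment> \<open>The number on which \<open>P\<close> runs the decider is the code of the pair
    built from \<open>P\<close>.\<close>
  have code: "encode_vas_pair (?V1, ?V2) = pair_code a b (n) (length zs)"
    unfolding encode_vas_pair.simps encode_vas_mkvas init pair_code_def Let_def a_def b_def ..
  have inst: "(?V1, ?V2) \<in> vas_pairs"
    by (simp add: vas_pairs_def is_vas_mkvas)
  define y where "y = (if (?V1, ?V2) \<in> ?E then 1 else 0 :: nat)"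
  have s0: "map s0 [0, 1, 2, 3] = [a, b, n, length zs]" "\<And>i. 4 \<le> i \<Longrightarrow> s0 i = 0"
    by (simp_all add: s0_def input_simps)
  have "rec_eval e (map s0 [0, 1, 2, 3]) (encode_vas_pair (?V1, ?V2))"
    using e[of "[a, b, n, length zs]"] unfolding s0(1) code by (simp add: numeral_3_eq_3)
  then have y: "rec_eval F (map s0 [0, 1, 2, 3]) y"
    using f[OF inst] unfolding F_def y_def by (intro rec_eval.Comp) auto
  have halts1: "(mstep D)\<^sup>*\<^sup>* (Some P, s0) (Some Skip, s0)" if "y = 1"
    using decision_prog_halts[OF y[unfolded that] s0(2)] machine_complete
    unfolding P_def D_def by blast
  have halts0: "\<not> halts" if "y = 0"
  proof
    assume halts
    then obtain s where "(mstep D)\<^sup>*\<^sup>* (Some P, s0) (Some Skip, s)" unfolding halts_def by blast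
    then have "prog_step\<^sup>*\<^sup>* (P, s0) (Skip, s)" using machine_sound unfolding D_def by blast
    with decision_prog_diverges[OF y[unfolded that] s0(2)] show False unfolding P_def by blast
  qed
  have "(?V1, ?V2) \<in> ?E \<longleftrightarrow> \<not> halts"
    unfolding mem_Collect_eq case_prod_conv
  proof (rule down_closure_eq_iff)
    show "set ds1 = lifts (insert (bonus (Some Skip)) (vass D m (Some P) None))"
      using ds1 by (simp add: V'_def V_def)
    show "set ds2 = lifts (vass D m (Some P) None)"
      using ds2 by (simp add: V_def)
    show "\<forall>d\<in>set ds1. \<forall>c. c \<notin> set (Cnt K # cs) \<longrightarrow> d c = 0"
      using lifts_support zs ds1 unfolding cs_def V'_def V_def by blast
    show "Cnt Y \<in> set cs" by (simp add: cs_def coords_def)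
    show "i < m" if "Cnt (X i) \<in> set cs" for i
      using coords_regs[OF zs, of i] that m4 unfolding cs_def by linarith
    show "i < m" if "Cnt (Xb i) \<in> set cs" for i
      using coords_regs[OF zs, of i] that m4 unfolding cs_def by linarith
    \<comment> \<open>Halting excludes answer 0, and the run for answer 1 ends in the store
      \<open>s0\<close>, where register 4 is zero.\<close>
    show "\<exists>s. (mstep D)\<^sup>*\<^sup>* (Some P, s0) (Some Skip, s) \<and> s 4 = 0" if halts
    proof -
      have "y = 1" using halts0 that unfolding y_def by argo
      with halts1 s0(2)[of 4] show ?thesis by auto
    qed
  qed
  moreover have "y = 1 \<Longrightarrow> halts" using halts1 unfolding halts_def by blast
  \<comment> \<open>Answer 1 asserts equal closures, hence no halting, yet makes \<open>P\<close>
    halt; answer 0 asserts different closures, hence halting, yet keeps \<open>P\<close> from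
    halting.\<close>
  ultimately show False using halts0 unfolding y_def by argo
qed

end
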